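(* Let $d\ge1$, $p\in[0,1]$, $p_d:=\frac{2d+1}{4d}$, and let $S$ be a multi-dimensional elephant random walk on $\mathbb{Z}^d$ with parameter $p$. For $x\in\mathbb{R}^d\setminus\{0\}$ write $\hat x:=x/\|x\|$. (i) If $p>p_d$, then $\lim_{n\to\infty}\hat S_n$ exists almost surely. (ii) If $d\ge3$ and $p\le p_d$, or if $d=2$ and $p=p_d$, then $\mathbb{P}\left(\lim_{n\to\infty}\hat S_n\text{ exists}\right)=0$.
   Context: Multi-dimensional elephant random walk (MERW): let $e_1,\dots,e_d$ be the standard basis of $\mathbb{R}^d$ and $p\in[0,1]$. Set $S_0=0$ and $S_1=\sigma_1=e_1$. For each $n\ge 1$, choose $n'$ uniformly at random in $\{1,\dots,n\}$ (independently of the past); given the past and $n'$, let $\sigma_{n+1}=\sigma_{n'}$ with probability $p$, and $\sigma_{n+1}=\sigma$ with probability $\frac{1-p}{2d-1}$ for each $\sigma\in\{\pm e_1,\dots,\pm e_d\}\setminus\{\sigma_{n'}\}$. Set $S_{n+1}=S_n+\sigma_{n+1}$. $\|\cdot\|$ is the Euclidean norm. In all cases considered the walk is transient (every vertex is almost surely visited only finitely often), so that almost surely $S_n\neq0$ and $\hat S_n$ is well defined for all large $n$; the limit is understood in the unit sphere $\mathbb{S}^{d-1}$. *)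

theory Defs
  imports "HOL-Probability.Probability"
begin

text \<open>
  The lattice \<open>\<int>\<^sup>d\<close> is viewed inside \<open>real ^ 'd\<close>, with \<open>d = CARD('d)\<close>.
  An index type carries no distinguished first element, so the index of \<open>e\<^sub>1\<close> is a
  parameter \<open>i1\<close>.
\<close>

definition unit_steps :: "(real ^ 'd) set" where
  "unit_steps = range (\<lambda>i. axis i 1) \<union> range (\<lambda>i. - axis i 1)"

text \<open>The sigma-algebra generated by \<open>\<sigma> 1, \<dots>, \<sigma> m\<close> and \<open>N 1, \<dots>, N n\<close>.\<close>

definition history ::
    "'w measure \<Rightarrow> (nat \<Rightarrow> 'w \<Rightarrow> real ^ 'd) \<Rightarrow> (nat \<Rightarrow> 'w \<Rightarrow> nat) \<Rightarrow> nat \<Rightarrow> nat \<Rightarrow> 'w measure" where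
  "history M \<sigma> N m n = sigma (space M)
     ({\<sigma> k -` A \<inter> space M | k A. k \<in> {1..m} \<and> A \<in> sets borel} \<union>
      {N k -` A \<inter> space M | k A. k \<in> {1..n}})"

text \<open>
  \<open>N n\<close> is the index (written \<open>n'\<close> on paper) drawn from \<open>{1..n}\<close> in order to produce
  \<open>\<sigma> (n + 1)\<close>. The past before this draw is generated by \<open>\<sigma> 1, \<dots>, \<sigma> n\<close> and the earlier
  draws \<open>N 1, \<dots>, N (n - 1)\<close>. The values \<open>\<sigma> 0\<close> and \<open>N 0\<close> play no role. That \<open>\<sigma> n\<close> lies
  in \<open>unit_steps\<close> almost surely follows from the transition rule, as the prescribed
  conditional probabilities sum to 1.
\<close>

locale elephant_random_walk = prob_space M
  for M :: "'w measure" +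
  fixes p :: real
    and i1 :: "'d :: finite"
    and N :: "nat \<Rightarrow> 'w \<Rightarrow> nat"
    and \<sigma> :: "nat \<Rightarrow> 'w \<Rightarrow> real ^ 'd"
    and S :: "nat \<Rightarrow> 'w \<Rightarrow> real ^ 'd"
  assumes p_range: "p \<in> {0..1}"
    and N_measurable: "\<And>n. n \<ge> 1 \<Longrightarrow> N n \<in> measurable M (count_space UNIV)"
    and step_measurable: "\<And>n. n \<ge> 1 \<Longrightarrow> \<sigma> n \<in> borel_measurable M"
    and S_0: "\<And>\<omega>. \<omega> \<in> space M \<Longrightarrow> S 0 \<omega> = 0"
    and S_Suc: "\<And>n \<omega>. \<omega> \<in> space M \<Longrightarrow> S (Suc n) \<omega> = S n \<omega> + \<sigma> (Suc n) \<omega>"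
    and step_1: "\<And>\<omega>. \<omega> \<in> space M \<Longrightarrow> \<sigma> 1 \<omega> = axis i1 1"
    and N_uniform: "\<And>n. n \<ge> 1 \<Longrightarrow>
          distr M (count_space UNIV) (N n) = measure_pmf (pmf_of_set {1..n})"
    and N_indep_past: "\<And>n. n \<ge> 1 \<Longrightarrow>
          indep_set (sets (history M \<sigma> N n (n - 1)))
                    (sets (vimage_algebra (space M) (N n) (count_space UNIV)))"
    and transition: "\<And>n v. n \<ge> 1 \<Longrightarrow> v \<in> unit_steps \<Longrightarrow>
          AE \<omega> in M. real_cond_exp M (history M \<sigma> N n n)
                       (indicator {\<omega>' \<in> space M. \<sigma> (Suc n) \<omega>' = v}) \<omega>
                   = (if v = \<sigma> (N n \<omega>) \<omega> then p else (1 - p) / (2 * real CARD('d) - 1))"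

text \<open>
  Since \<open>0 /\<^sub>R norm 0 = 0\<close> is not on the unit sphere, a limit on the sphere forces
  \<open>s n \<noteq> 0\<close> for all large \<open>n\<close>; finitely many zeros of \<open>s\<close> are harmless.
\<close>

definition direction_converges :: "(nat \<Rightarrow> real ^ 'd) \<Rightarrow> bool" where
  "direction_converges s \<longleftrightarrow> (\<exists>L \<in> sphere 0 1. (\<lambda>n. s n /\<^sub>R norm (s n)) \<longlonglongrightarrow> L)"

definition p_crit :: "nat \<Rightarrow> real" where
  "p_crit d = (2 * real d + 1) / (4 * real d)"

end

theory Submission imports Defs begin

text \<open>
Put \<open>q = (1 - p) / (2d - 1)\<close> and \<open>a = p - q\<close>. Averaging over the uniformly drawn index, the
conditional probability that step \<open>m + 1\<close> equals \<open>v\<close> is \<open>q + a c / m\<close>, where \<open>c\<close> counts the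
earlier steps equal to \<open>v\<close>. Hence a coordinate \<open>X\<close> of the walk satisfies
\<open>E[X' - X | past] = a X / m\<close>, and the conditional second moment of its steps is bounded
away from \<open>0\<close> as soon as \<open>p < 1\<close>. The condition \<open>p > p_crit d\<close> is the same as \<open>a > 1/2\<close>.

For \<open>a \<ge> 0\<close> the coordinates, divided by \<open>growth a n = (1 + a) (1 + a/2) \<dots> (1 + a/n)\<close>,
are martingales. This product has order \<open>n\<^sup>a\<close>, and the regimes are separated by the convergence of \<open>\<Sum> 1 / growth a n ^ 2\<close>.

If \<open>a > 1/2\<close>, this series converges, so the normalised walk converges almost surely by the
maximal inequality (\<open>bounded_martingale.converges\<close>). The direction then converges provided
that the limit \<open>L\<close> is not \<open>0\<close>, and this is the main point
(\<open>nondegenerate_martingale.limit_nonzero\<close>). Let \<open>R n\<close> be the tail at \<open>n\<close> of the sum of the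
squared increment bounds. Given the past at time \<open>n\<close>, the second moment of the remaining
fluctuation is at least a fixed multiple of \<open>R n\<close> and its fourth moment is at most a fixed
multiple of \<open>(R n)\<^sup>2\<close>, so a second moment argument bounds \<open>P(L \<noteq> 0 | past)\<close> from below by a
constant that depends neither on \<open>n\<close> nor on the past. Applied on the events that the
martingale is already close to \<open>0\<close>, the bound excludes \<open>L = 0\<close>. For \<open>p = 1\<close> the walk is
deterministic and is treated by hand.

If \<open>a \<le> 1/2\<close>, each coordinate returns to the half-line \<open>(-\<infinity>, 0]\<close> infinitely often
(\<open>elephant_random_walk.not_eventually_positive\<close>). While positive, the suitably normalised
coordinate is a supermartingale, so by gambler's ruin it is unlikely to reach a high level
before \<open>0\<close>, and it cannot stay between \<open>0\<close> and a level forever because its accumulated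
variance diverges. The same holds for each \<open>- axis i 1\<close>. A walk whose direction converges to
some \<open>L\<close> on the sphere would have a coordinate of constant sign from some time on, namely
one in which \<open>L\<close> does not vanish.
\<close>

section \<open>Bounded weights and a maximal inequality\<close>

locale filtered_prob_space = prob_space M for M :: "'w measure" +
  fixes F :: "nat \<Rightarrow> 'w measure"
  assumes subalg: "\<And>n. subalgebra M (F n)"
    and F_mono: "\<And>m n. m \<le> n \<Longrightarrow> sets (F m) \<subseteq> sets (F n)"
begin

text \<open>
Conditional expectations given the past are tested against bounded weights that are
measurable at the present time. Essential boundedness is used because the position of the
walk is only almost surely bounded. The class is closed under the algebraic operations, which
settles all integrability questions.
\<close>

definition bounded_at :: "nat \<Rightarrow> ('w \<Rightarrow> real) \<Rightarrow> bool" where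
  "bounded_at n f \<longleftrightarrow> f \<in> borel_measurable (F n) \<and> (\<exists>C. AE \<omega> in M. \<bar>f \<omega>\<bar> \<le> C)"

lemma space_F [simp]: "space (F n) = space M"
  using subalg[of n] by (simp add: subalgebra_def)

lemma sets_F: "A \<in> sets (F n) \<Longrightarrow> A \<in> sets M"
  using subalg[of n] by (auto simp: subalgebra_def)

lemma bounded_atI:
  assumes "f \<in> borel_measurable (F n)" "AE \<omega> in M. \<bar>f \<omega>\<bar> \<le> C"
  shows "bounded_at n f"
  using assms by (auto simp: bounded_at_def)

lemma bounded_at_measurable [measurable_dest]: "bounded_at n f \<Longrightarrow> f \<in> borel_measurable (F n)"
  by (simp add: bounded_at_def)

lemma bounded_at_measurable_M: "bounded_at n f \<Longrightarrow> f \<in> borel_measurable M"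
  using measurable_from_subalg[OF subalg] by (auto simp: bounded_at_def)

lemma bounded_at_integrable:
  assumes "bounded_at n f" shows "integrable M f"
proof -
  obtain C where "AE \<omega> in M. \<bar>f \<omega>\<bar> \<le> C" using assms by (auto simp: bounded_at_def)
  then show ?thesis
    using bounded_at_measurable_M[OF assms] by (intro integrable_const_bound[where B = C]) auto
qed

lemma bounded_at_mono:
  assumes "m \<le> n" "bounded_at m f" shows "bounded_at n f"
proof -
  have "subalgebra (F n) (F m)" using F_mono[OF assms(1)] by (simp add: subalgebra_def)
  then show ?thesis using assms(2) measurable_from_subalg by (auto simp: bounded_at_def)
qed

lemma bounded_at_const [simp, intro!]: "bounded_at n (\<lambda>_. c)"
  by (auto simp: bounded_at_def)

lemma bounded_at_add [intro!]:
  assumes "bounded_at n f" "bounded_at n g" shows "bounded_at n (\<lambda>\<omega>. f \<omega> + g \<omega>)"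
proof -
  obtain C D where "AE \<omega> in M. \<bar>f \<omega>\<bar> \<le> C" "AE \<omega> in M. \<bar>g \<omega>\<bar> \<le> D"
    using assms by (auto simp: bounded_at_def)
  then have "AE \<omega> in M. \<bar>f \<omega> + g \<omega>\<bar> \<le> C + D" by eventually_elim auto
  then show ?thesis using assms by (auto simp: bounded_at_def)
qed

lemma bounded_at_mult [intro!]:
  assumes "bounded_at n f" "bounded_at n g" shows "bounded_at n (\<lambda>\<omega>. f \<omega> * g \<omega>)"
proof -
  obtain C D where "AE \<omega> in M. \<bar>f \<omega>\<bar> \<le> C" "AE \<omega> in M. \<bar>g \<omega>\<bar> \<le> D"
    using assms by (auto simp: bounded_at_def)
  then have "AE \<omega> in M. \<bar>f \<omega> * g \<omega>\<bar> \<le> C * D"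
    by eventually_elim (auto simp: abs_mult intro!: mult_mono)
  then show ?thesis using assms by (auto simp: bounded_at_def)
qed

lemma bounded_at_diff [intro!]:
  assumes "bounded_at n f" "bounded_at n g" shows "bounded_at n (\<lambda>\<omega>. f \<omega> - g \<omega>)"
  using bounded_at_add[OF assms(1) bounded_at_mult[OF bounded_at_const[of n "-1"] assms(2)]] by simp

lemma bounded_at_divide [intro!]:
  assumes "bounded_at n f" shows "bounded_at n (\<lambda>\<omega>. f \<omega> / c)"
  using bounded_at_mult[OF bounded_at_const[of n "1/c"] assms] by simp

lemma bounded_at_power [intro!]:
  "bounded_at n f \<Longrightarrow> bounded_at n (\<lambda>\<omega>. f \<omega> ^ k)"
  by (induction k) auto

lemma bounded_at_sum:
  "(\<And>i. i \<in> I \<Longrightarrow> bounded_at n (f i)) \<Longrightarrow> bounded_at n (\<lambda>\<omega>. \<Sum>i\<in>I. f i \<omega>)"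
  by (induction I rule: infinite_finite_induct) auto

lemma bounded_at_indicator [intro!]: "A \<in> sets (F n) \<Longrightarrow> bounded_at n (indicator A)"
  by (rule bounded_atI[where C = 1]) (auto simp: indicator_def)

lemma bounded_at_level_set: "bounded_at n f \<Longrightarrow> {\<omega> \<in> space M. a \<le> f \<omega>} \<in> sets (F n)"
  using borel_measurable_iff_ge[of f "F n"] by (auto dest: bounded_at_measurable)

text \<open>
Doob's maximal inequality. On the part of the event that is added at time \<open>m + 1\<close> the process
is at least \<open>c\<close> at that very time, while on the earlier part the expectation of \<open>T\<close> can only
have grown.
\<close>
lemma submartingale_maximal_inequality:
  assumes T: "\<And>k. n \<le> k \<Longrightarrow> bounded_at k (T k)"
    and nonneg: "\<And>k \<omega>. 0 \<le> T k \<omega>"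
    and sub: "\<And>k A. n \<le> k \<Longrightarrow> A \<in> sets (F k) \<Longrightarrow>
      expectation (\<lambda>\<omega>. indicator A \<omega> * T k \<omega>) \<le> expectation (\<lambda>\<omega>. indicator A \<omega> * T (Suc k) \<omega>)"
    and "n \<le> m"
  shows "c * prob {\<omega> \<in> space M. \<exists>k\<in>{n..m}. c \<le> T k \<omega>} \<le> expectation (T m)"
proof -
  define H where "H m = {\<omega> \<in> space M. \<exists>k\<in>{n..m}. c \<le> T k \<omega>}" for m
  have HF: "H m \<in> sets (F m)" for m
  proof -
    have "{\<omega> \<in> space M. c \<le> T k \<omega>} \<in> sets (F m)" if "k \<in> {n..m}" for k
      using bounded_at_level_set[OF bounded_at_mono[OF _ T, of k m]] that by simp
    then have "(\<Union>k\<in>{n..m}. {\<omega> \<in> space M. c \<le> T k \<omega>}) \<in> sets (F m)"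
      by (intro sets.finite_UN) auto
    also have "(\<Union>k\<in>{n..m}. {\<omega> \<in> space M. c \<le> T k \<omega>}) = H m" by (auto simp: H_def)
    finally show ?thesis .
  qed
  have "c * prob (H m) \<le> expectation (\<lambda>\<omega>. indicator (H m) \<omega> * T m \<omega>)"
    using \<open>n \<le> m\<close>
  proof (induction m rule: dec_induct)
    case base
    have "expectation (\<lambda>\<omega>. indicator (H n) \<omega> * c) \<le> expectation (\<lambda>\<omega>. indicator (H n) \<omega> * T n \<omega>)"
    proof (intro integral_mono bounded_at_integrable[of n])
      show "indicator (H n) \<omega> * c \<le> indicator (H n) \<omega> * T n \<omega>" for \<omega>
        by (auto simp: H_def indicator_def)
    qed (use HF[of n] T[of n] in auto)
    then show ?case using sets_F[OF HF[of n]] by (simp add: mult.commute)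
  next
    case (step m)
    define B where "B = H (Suc m) - H m"
    have sub': "H m \<subseteq> H (Suc m)" by (force simp: H_def)
    have HS: "H m \<in> sets (F (Suc m))" using HF[of m] F_mono[of m "Suc m"] by auto
    then have BF: "B \<in> sets (F (Suc m))" using HF[of "Suc m"] by (auto simp: B_def)
    have TB: "bounded_at (Suc m) (T (Suc m))" using T step by simp
    have Bc: "c \<le> T (Suc m) \<omega>" if "\<omega> \<in> B" for \<omega>
      using that by (auto simp: B_def H_def le_Suc_eq)
    have split: "indicator (H (Suc m)) \<omega> = (indicator (H m) \<omega> + indicator B \<omega> :: real)" for \<omega>
      using sub' by (auto simp: B_def indicator_def)
    have "expectation (\<lambda>\<omega>. indicator B \<omega> * c) \<le> expectation (\<lambda>\<omega>. indicator B \<omega> * T (Suc m) \<omega>)"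
    proof (intro integral_mono bounded_at_integrable[of "Suc m"])
      show "indicator B \<omega> * c \<le> indicator B \<omega> * T (Suc m) \<omega>" for \<omega>
        using Bc by (auto simp: indicator_def)
    qed (use BF TB in auto)
    then have 1: "c * prob B \<le> expectation (\<lambda>\<omega>. indicator B \<omega> * T (Suc m) \<omega>)"
      using sets_F[OF BF] by (simp add: mult.commute)
    have "prob (H (Suc m)) = prob (H m \<union> B)" using sub' by (simp add: B_def Un_absorb1)
    also have "\<dots> = prob (H m) + prob B"
      using sets_F[OF HF[of m]] sets_F[OF BF] by (intro finite_measure_Union) (auto simp: B_def)
    finally have "c * prob (H (Suc m)) = c * prob (H m) + c * prob B" by (simp add: algebra_simps)
    also have "\<dots> \<le> expectation (\<lambda>\<omega>. indicator (H m) \<omega> * T (Suc m) \<omega>)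
                  + expectation (\<lambda>\<omega>. indicator B \<omega> * T (Suc m) \<omega>)"
      using 1 step sub[of m "H m"] HF[of m] by linarith
    also have "\<dots> = expectation (\<lambda>\<omega>. indicator (H m) \<omega> * T (Suc m) \<omega> + indicator B \<omega> * T (Suc m) \<omega>)"
      using BF TB HS
      by (intro Bochner_Integration.integral_add[symmetric] bounded_at_integrable[of "Suc m"]) auto
    also have "\<dots> = expectation (\<lambda>\<omega>. indicator (H (Suc m)) \<omega> * T (Suc m) \<omega>)"
      by (simp add: split algebra_simps)
    finally show ?case .
  qed
  also have "\<dots> \<le> expectation (T m)"
  proof (intro integral_mono bounded_at_integrable[of m])
    show "indicator (H m) \<omega> * T m \<omega> \<le> T m \<omega>" for \<omega>
      using nonneg[of m \<omega>] by (auto simp: indicator_def)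
  qed (use T[OF \<open>n \<le> m\<close>] HF[of m] in auto)
  finally show ?thesis by (simp add: H_def)
qed

end

section \<open>Martingales with square-summable increment bounds\<close>

locale bounded_martingale = filtered_prob_space +
  fixes Y :: "nat \<Rightarrow> 'a \<Rightarrow> real" and c :: "nat \<Rightarrow> real"
  assumes bounded: "\<And>n. bounded_at n (Y n)"
    and fair: "\<And>n f. bounded_at n f \<Longrightarrow>
        expectation (\<lambda>\<omega>. f \<omega> * Y (Suc n) \<omega>) = expectation (\<lambda>\<omega>. f \<omega> * Y n \<omega>)"
    and increment: "\<And>n. AE \<omega> in M. \<bar>Y (Suc n) \<omega> - Y n \<omega>\<bar> \<le> c n"
    and c_pos: "\<And>n. 0 < c n"
    and c_summable: "summable (\<lambda>n. (c n)\<^sup>2)"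
begin

abbreviation \<xi> :: "nat \<Rightarrow> 'a \<Rightarrow> real" where "\<xi> n \<omega> \<equiv> Y (Suc n) \<omega> - Y n \<omega>"

lemma bounded_le: "m \<le> n \<Longrightarrow> bounded_at n (Y m)"
  using bounded bounded_at_mono by blast

lemma increment_orthogonal:
  assumes "bounded_at n f" shows "expectation (\<lambda>\<omega>. f \<omega> * \<xi> n \<omega>) = 0"
proof -
  have "expectation (\<lambda>\<omega>. f \<omega> * Y (Suc n) \<omega> - f \<omega> * Y n \<omega>) =
    expectation (\<lambda>\<omega>. f \<omega> * Y (Suc n) \<omega>) - expectation (\<lambda>\<omega>. f \<omega> * Y n \<omega>)"
    using bounded_at_mono[of n "Suc n" f] assms bounded_le
    by (intro Bochner_Integration.integral_diff bounded_at_integrable[of "Suc n"]) auto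
  then show ?thesis using fair[OF assms] by (simp add: algebra_simps)
qed

lemma square_step:
  assumes f: "bounded_at n f" and Z: "bounded_at n Z"
  shows "expectation (\<lambda>\<omega>. f \<omega> * (Z \<omega> + \<xi> n \<omega>)\<^sup>2) =
         expectation (\<lambda>\<omega>. f \<omega> * (Z \<omega>)\<^sup>2) + expectation (\<lambda>\<omega>. f \<omega> * (\<xi> n \<omega>)\<^sup>2)"
proof -
  note b = bounded_at_mono[of n "Suc n", OF _ f] bounded_at_mono[of n "Suc n", OF _ Z]
    bounded_le[of n "Suc n"] bounded[of "Suc n"]
  have i: "bounded_at (Suc n) (\<lambda>\<omega>. f \<omega> * (Z \<omega>)\<^sup>2)" "bounded_at (Suc n) (\<lambda>\<omega>. 2 * f \<omega> * Z \<omega> * \<xi> n \<omega>)"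
    "bounded_at (Suc n) (\<lambda>\<omega>. f \<omega> * (\<xi> n \<omega>)\<^sup>2)"
    using b by auto
  have "expectation (\<lambda>\<omega>. f \<omega> * (Z \<omega> + \<xi> n \<omega>)\<^sup>2) =
    expectation (\<lambda>\<omega>. (f \<omega> * (Z \<omega>)\<^sup>2 + 2 * f \<omega> * Z \<omega> * \<xi> n \<omega>) + f \<omega> * (\<xi> n \<omega>)\<^sup>2)"
    by (intro Bochner_Integration.integral_cong) (auto simp: power2_eq_square algebra_simps)
  also have "\<dots> = expectation (\<lambda>\<omega>. f \<omega> * (Z \<omega>)\<^sup>2) + expectation (\<lambda>\<omega>. 2 * f \<omega> * Z \<omega> * \<xi> n \<omega>)
      + expectation (\<lambda>\<omega>. f \<omega> * (\<xi> n \<omega>)\<^sup>2)"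
    using i[THEN bounded_at_integrable]
    by (simp only: Bochner_Integration.integral_add Bochner_Integration.integrable_add)
  moreover have "bounded_at n (\<lambda>\<omega>. 2 * f \<omega> * Z \<omega>)" using f Z by auto
  ultimately show ?thesis using increment_orthogonal[of n "\<lambda>\<omega>. 2 * f \<omega> * Z \<omega>"] by simp
qed

lemma square_increment_le:
  assumes f: "bounded_at n f" and f0: "\<And>\<omega>. 0 \<le> f \<omega>"
  shows "expectation (\<lambda>\<omega>. f \<omega> * (\<xi> n \<omega>)\<^sup>2) \<le> (c n)\<^sup>2 * expectation f"
proof -
  note b = bounded_at_mono[of n "Suc n", OF _ f] bounded_le[of n "Suc n"] bounded[of "Suc n"]
  have "expectation (\<lambda>\<omega>. f \<omega> * (\<xi> n \<omega>)\<^sup>2) \<le> expectation (\<lambda>\<omega>. (c n)\<^sup>2 * f \<omega>)"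
  proof (intro integral_mono_AE bounded_at_integrable[of "Suc n"])
    show "AE \<omega> in M. f \<omega> * (\<xi> n \<omega>)\<^sup>2 \<le> (c n)\<^sup>2 * f \<omega>"
      using increment[of n]
    proof eventually_elim
      case (elim \<omega>)
      then have "(\<xi> n \<omega>)\<^sup>2 \<le> (c n)\<^sup>2" using abs_le_square_iff c_pos[of n] by force
      then show ?case using f0[of \<omega>] by (simp add: mult.commute mult_left_mono)
    qed
  qed (use b in auto)
  then show ?thesis by simp
qed

text \<open>
Only the term linear in the increment is orthogonal to the past; the cubic term \<open>4 Z \<xi>\<^sup>3\<close> is
absorbed by \<open>2 Z\<^sup>2 \<xi>\<^sup>2 + 2 \<xi>\<^sup>4\<close>.
\<close>

lemma fourth_power_step:
  assumes f: "bounded_at n f" and f0: "\<And>\<omega>. 0 \<le> f \<omega>" and Z: "bounded_at n Z"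
  shows "expectation (\<lambda>\<omega>. f \<omega> * (Z \<omega> + \<xi> n \<omega>) ^ 4) \<le>
         expectation (\<lambda>\<omega>. f \<omega> * (Z \<omega>) ^ 4) + 8 * (c n)\<^sup>2 * expectation (\<lambda>\<omega>. f \<omega> * (Z \<omega>)\<^sup>2)
         + 3 * (c n) ^ 4 * expectation f"
proof -
  note b = bounded_at_mono[of n "Suc n", OF _ f] bounded_at_mono[of n "Suc n", OF _ Z]
    bounded_le[of n "Suc n"] bounded[of "Suc n"]
  have i: "bounded_at (Suc n) (\<lambda>\<omega>. f \<omega> * (Z \<omega>) ^ 4)" "bounded_at (Suc n) (\<lambda>\<omega>. 4 * f \<omega> * (Z \<omega>) ^ 3 * \<xi> n \<omega>)"
    "bounded_at (Suc n) (\<lambda>\<omega>. 8 * (c n)\<^sup>2 * (f \<omega> * (Z \<omega>)\<^sup>2))" "bounded_at (Suc n) (\<lambda>\<omega>. 3 * (c n) ^ 4 * f \<omega>)"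
    using b by auto
  have pw: "(z + x) ^ 4 \<le> z ^ 4 + 4 * z ^ 3 * x + 8 * e\<^sup>2 * z\<^sup>2 + 3 * e ^ 4"
    if "\<bar>x\<bar> \<le> e" for z x e :: real
  proof -
    have e0: "0 \<le> e" using that by simp
    have x2: "x\<^sup>2 \<le> e\<^sup>2" using that by (simp add: abs_le_square_iff[symmetric])
    have "(z + x) ^ 4 = z ^ 4 + 4 * z ^ 3 * x + (6 * z\<^sup>2 * x\<^sup>2 + 4 * (z * x) * x\<^sup>2 + x\<^sup>2 * x\<^sup>2)"
      by (simp add: power2_eq_square power3_eq_cube power4_eq_xxxx algebra_simps)
    also have "6 * z\<^sup>2 * x\<^sup>2 + 4 * (z * x) * x\<^sup>2 + x\<^sup>2 * x\<^sup>2 \<le> (8 * z\<^sup>2 + 3 * x\<^sup>2) * x\<^sup>2"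
    proof -
      have "0 \<le> 2 * (z - x)\<^sup>2 * x\<^sup>2" by simp
      then show ?thesis by (simp add: power2_eq_square algebra_simps)
    qed
    also have "\<dots> \<le> (8 * z\<^sup>2 + 3 * e\<^sup>2) * e\<^sup>2" using x2 by (intro mult_mono) auto
    finally show ?thesis by (simp add: power2_eq_square power4_eq_xxxx algebra_simps)
  qed
  have "expectation (\<lambda>\<omega>. f \<omega> * (Z \<omega> + \<xi> n \<omega>) ^ 4) \<le>
    expectation (\<lambda>\<omega>. f \<omega> * (Z \<omega>) ^ 4 + 4 * f \<omega> * (Z \<omega>) ^ 3 * \<xi> n \<omega>
      + 8 * (c n)\<^sup>2 * (f \<omega> * (Z \<omega>)\<^sup>2) + 3 * (c n) ^ 4 * f \<omega>)"
  proof (intro integral_mono_AE bounded_at_integrable[of "Suc n"])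
    show "AE \<omega> in M. f \<omega> * (Z \<omega> + \<xi> n \<omega>) ^ 4 \<le> f \<omega> * (Z \<omega>) ^ 4 + 4 * f \<omega> * (Z \<omega>) ^ 3 * \<xi> n \<omega>
      + 8 * (c n)\<^sup>2 * (f \<omega> * (Z \<omega>)\<^sup>2) + 3 * (c n) ^ 4 * f \<omega>"
      using increment[of n]
    proof eventually_elim
      case (elim \<omega>)
      have "f \<omega> * (Z \<omega> + \<xi> n \<omega>) ^ 4 \<le> f \<omega> *
        ((Z \<omega>) ^ 4 + 4 * (Z \<omega>) ^ 3 * \<xi> n \<omega> + 8 * (c n)\<^sup>2 * (Z \<omega>)\<^sup>2 + 3 * (c n) ^ 4)"
        by (intro mult_left_mono pw elim f0)
      then show ?case by (simp add: algebra_simps)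
    qed
  qed (use b i in auto)
  also have "\<dots> = expectation (\<lambda>\<omega>. f \<omega> * (Z \<omega>) ^ 4) + expectation (\<lambda>\<omega>. 4 * f \<omega> * (Z \<omega>) ^ 3 * \<xi> n \<omega>)
      + expectation (\<lambda>\<omega>. 8 * (c n)\<^sup>2 * (f \<omega> * (Z \<omega>)\<^sup>2)) + expectation (\<lambda>\<omega>. 3 * (c n) ^ 4 * f \<omega>)"
    using i[THEN bounded_at_integrable]
    by (simp only: Bochner_Integration.integral_add Bochner_Integration.integrable_add)
  finally have "expectation (\<lambda>\<omega>. f \<omega> * (Z \<omega> + \<xi> n \<omega>) ^ 4) \<le>
      expectation (\<lambda>\<omega>. f \<omega> * (Z \<omega>) ^ 4) + expectation (\<lambda>\<omega>. 4 * f \<omega> * (Z \<omega>) ^ 3 * \<xi> n \<omega>)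
      + expectation (\<lambda>\<omega>. 8 * (c n)\<^sup>2 * (f \<omega> * (Z \<omega>)\<^sup>2)) + expectation (\<lambda>\<omega>. 3 * (c n) ^ 4 * f \<omega>)" .
  moreover have "bounded_at n (\<lambda>\<omega>. 4 * f \<omega> * (Z \<omega>) ^ 3)" using f Z by auto
  ultimately show ?thesis using increment_orthogonal[of n "\<lambda>\<omega>. 4 * f \<omega> * (Z \<omega>) ^ 3"] by simp
qed

definition R :: "nat \<Rightarrow> real" where "R n = (\<Sum>k. (c (k + n))\<^sup>2)"

lemma sum_le_R: "n \<le> m \<Longrightarrow> (\<Sum>k=n..<m. (c k)\<^sup>2) \<le> R n"
proof -
  assume "n \<le> m"
  have "(\<Sum>k=n..<m. (c k)\<^sup>2) = (\<Sum>k<m - n. (c (k + n))\<^sup>2)"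
    using \<open>n \<le> m\<close> sum.shift_bounds_nat_ivl[of "\<lambda>k. (c k)\<^sup>2" 0 n "m - n"] by (simp add: lessThan_atLeast0)
  also have "\<dots> \<le> R n"
    unfolding R_def using c_summable summable_iff_shift[of "\<lambda>k. (c k)\<^sup>2" n]
    by (intro sum_le_suminf) auto
  finally show ?thesis .
qed

lemma R_pos: "0 < R n"
  unfolding R_def using c_pos c_summable
  by (intro suminf_pos) (auto simp: summable_iff_shift[of "\<lambda>n. (c n)\<^sup>2"] less_imp_neq[THEN not_sym])

lemma R_tendsto: "R \<longlonglongrightarrow> 0"
  unfolding R_def using suminf_exist_split2[OF c_summable] by simp

lemma square_deviation:
  assumes "n \<le> m" and f: "bounded_at n f" and f0: "\<And>\<omega>. 0 \<le> f \<omega>"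
  shows "expectation (\<lambda>\<omega>. f \<omega> * (Y m \<omega> - Y n \<omega>)\<^sup>2) \<le> (\<Sum>k=n..<m. (c k)\<^sup>2) * expectation f"
  using \<open>n \<le> m\<close>
proof (induction m rule: dec_induct)
  case (step m)
  have fm: "bounded_at m f" using bounded_at_mono f step by blast
  have "expectation (\<lambda>\<omega>. f \<omega> * (Y (Suc m) \<omega> - Y n \<omega>)\<^sup>2) =
    expectation (\<lambda>\<omega>. f \<omega> * (Y m \<omega> - Y n \<omega>)\<^sup>2) + expectation (\<lambda>\<omega>. f \<omega> * (\<xi> m \<omega>)\<^sup>2)"
    using square_step[OF fm, of "\<lambda>\<omega>. Y m \<omega> - Y n \<omega>"] step bounded_le by auto
  also have "\<dots> \<le> (\<Sum>k=n..<m. (c k)\<^sup>2) * expectation f + (c m)\<^sup>2 * expectation f"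
    using step.IH square_increment_le[OF fm f0] by linarith
  finally show ?case using step by (simp add: algebra_simps)
qed auto

text \<open>
By the maximal inequality for the submartingale \<open>(Y k - Y n)\<^sup>2\<close>, the probability of an oscillation
of size \<open>\<epsilon>\<close> after time \<open>n\<close> is at most \<open>R n / \<epsilon>\<^sup>2\<close>, which tends to \<open>0\<close>; so almost every path is
Cauchy.
\<close>

lemma converges: "AE \<omega> in M. convergent (\<lambda>n. Y n \<omega>)"
proof -
  have tail: "\<epsilon>\<^sup>2 * prob {\<omega> \<in> space M. \<exists>k\<ge>n. \<epsilon> \<le> \<bar>Y k \<omega> - Y n \<omega>\<bar>} \<le> R n" if "\<epsilon> > 0" for n \<epsilon>
  proof -
    define T where "T k \<omega> = (Y k \<omega> - Y n \<omega>)\<^sup>2" for k \<omega>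
    have TB: "bounded_at k (T k)" if "n \<le> k" for k
      unfolding T_def using bounded_le[OF that] bounded[of k] by auto
    have T_sub: "expectation (\<lambda>\<omega>. indicator A \<omega> * T k \<omega>) \<le> expectation (\<lambda>\<omega>. indicator A \<omega> * T (Suc k) \<omega>)"
      if "n \<le> k" "A \<in> sets (F k)" for k A
    proof -
      have "expectation (\<lambda>\<omega>. indicator A \<omega> * T (Suc k) \<omega>) = expectation (\<lambda>\<omega>. indicator A \<omega> * T k \<omega>)
        + expectation (\<lambda>\<omega>. indicator A \<omega> * (\<xi> k \<omega>)\<^sup>2)"
        using square_step[of k "indicator A" "\<lambda>\<omega>. Y k \<omega> - Y n \<omega>"] that bounded_le by (auto simp: T_def)
      moreover have "0 \<le> expectation (\<lambda>\<omega>. indicator A \<omega> * (\<xi> k \<omega>)\<^sup>2)" by simp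
      ultimately show ?thesis by linarith
    qed
    define H where "H m = {\<omega> \<in> space M. \<exists>k\<in>{n..m}. \<epsilon>\<^sup>2 \<le> T k \<omega>}" for m
    have Tm: "T k \<in> borel_measurable M" for k
      unfolding T_def using bounded_at_measurable_M[OF bounded] by measurable
    have HM: "H m \<in> sets M" for m unfolding H_def using Tm by measurable
    have "\<epsilon>\<^sup>2 * prob (H m) \<le> R n" for m
    proof (cases "n \<le> m")
      case True
      have "\<epsilon>\<^sup>2 * prob (H m) \<le> expectation (T m)"
        unfolding H_def by (rule submartingale_maximal_inequality[OF TB _ T_sub True]) (auto simp: T_def)
      also have "\<dots> \<le> (\<Sum>k=n..<m. (c k)\<^sup>2)"
        using square_deviation[OF True, of "\<lambda>_. 1"] by (simp add: T_def[abs_def] prob_space)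
      finally show ?thesis using sum_le_R[OF True] by linarith
    next
      case False
      then show ?thesis using R_pos[of n] by (simp add: H_def)
    qed
    moreover have "(\<lambda>m. prob (H m)) \<longlonglongrightarrow> prob (\<Union>m. H m)"
      using HM by (intro finite_Lim_measure_incseq) (auto simp: incseq_def H_def)
    ultimately have "\<epsilon>\<^sup>2 * prob (\<Union>m. H m) \<le> R n"
      by (intro LIMSEQ_le_const2[OF tendsto_mult[OF tendsto_const]]) auto
    moreover have "(\<Union>m. H m) = {\<omega> \<in> space M. \<exists>k\<ge>n. \<epsilon> \<le> \<bar>Y k \<omega> - Y n \<omega>\<bar>}"
      using that by (force simp: H_def T_def abs_le_square_iff[symmetric])
    ultimately show ?thesis by simp
  qed
  have "AE \<omega> in M. \<exists>n. \<forall>k\<ge>n. \<bar>Y k \<omega> - Y n \<omega>\<bar> < 1 / real (Suc j)" for j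
  proof -
    define \<epsilon> where "\<epsilon> = 1 / real (Suc j)"
    have eps: "\<epsilon> > 0" by (simp add: \<epsilon>_def)
    note [measurable] = bounded_at_measurable_M[OF bounded]
    define B where "B = {\<omega> \<in> space M. \<forall>n. \<exists>k\<ge>n. \<epsilon> \<le> \<bar>Y k \<omega> - Y n \<omega>\<bar>}"
    have [measurable]: "B \<in> sets M" unfolding B_def by measurable
    have "\<epsilon>\<^sup>2 * prob B \<le> R n" for n
    proof -
      have "prob B \<le> prob {\<omega> \<in> space M. \<exists>k\<ge>n. \<epsilon> \<le> \<bar>Y k \<omega> - Y n \<omega>\<bar>}"
        by (intro finite_measure_mono) (auto simp: B_def)
      then show ?thesis using tail[OF eps, of n] eps by (meson mult_left_mono order_trans zero_le_power2)
    qed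
    then have "\<epsilon>\<^sup>2 * prob B \<le> 0" by (intro LIMSEQ_le_const[OF R_tendsto]) auto
    then have "prob B = 0" using eps by (simp add: mult_le_0_iff measure_le_0_iff)
    then have "AE \<omega> in M. \<omega> \<notin> B" by (intro AE_not_in) (auto simp: null_sets_def emeasure_eq_measure)
    then show ?thesis
      using AE_space
    proof eventually_elim
      case (elim \<omega>)
      then obtain n where "\<And>k. k \<ge> n \<Longrightarrow> \<not> \<epsilon> \<le> \<bar>Y k \<omega> - Y n \<omega>\<bar>" by (auto simp: B_def)
      then show ?case unfolding \<epsilon>_def not_le by blast
    qed
  qed
  then have "AE \<omega> in M. \<forall>j. \<exists>n. \<forall>k\<ge>n. \<bar>Y k \<omega> - Y n \<omega>\<bar> < 1 / real (Suc j)"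
    by (simp add: AE_all_countable)
  then show ?thesis
  proof eventually_elim
    case (elim \<omega>)
    have "Cauchy (\<lambda>n. Y n \<omega>)"
    proof (rule CauchyI')
      fix e :: real assume "0 < e"
      then obtain j where j: "1 / real (Suc j) < e / 2"
        using reals_Archimedean[of "e / 2"] by (auto simp: inverse_eq_divide)
      obtain n where n: "\<And>k. k \<ge> n \<Longrightarrow> \<bar>Y k \<omega> - Y n \<omega>\<bar> < 1 / real (Suc j)" using elim by blast
      show "\<exists>M. \<forall>m\<ge>M. \<forall>n>m. dist (Y m \<omega>) (Y n \<omega>) < e"
      proof (intro exI[of _ n] allI impI)
        fix k l assume "k \<ge> n" "l > k"
        then show "dist (Y k \<omega>) (Y l \<omega>) < e"
          using n[of k] n[of l] j unfolding dist_real_def by linarith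
      qed
    qed
    then show ?case by (simp add: Cauchy_convergent_iff)
  qed
qed

text \<open>
The fourth moment is of the order of the squared variance. This comparability of moments is
what the second moment argument for the limit rests on.
\<close>

lemma fourth_power_deviation:
  assumes "n \<le> m" and f: "bounded_at n f" and f0: "\<And>\<omega>. 0 \<le> f \<omega>"
  shows "expectation (\<lambda>\<omega>. f \<omega> * (Y m \<omega> - Y n \<omega>) ^ 4) \<le> 11 * (R n)\<^sup>2 * expectation f"
proof -
  have Ef: "0 \<le> expectation f" using f0 by simp
  have "expectation (\<lambda>\<omega>. f \<omega> * (Y m \<omega> - Y n \<omega>) ^ 4) \<le> 11 * R n * (\<Sum>k=n..<m. (c k)\<^sup>2) * expectation f"
    using \<open>n \<le> m\<close>
  proof (induction m rule: dec_induct)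
    case (step m)
    have fm: "bounded_at m f" using bounded_at_mono f step by blast
    have D: "expectation (\<lambda>\<omega>. f \<omega> * (Y m \<omega> - Y n \<omega>)\<^sup>2) \<le> R n * expectation f"
      using square_deviation[OF \<open>n \<le> m\<close> f f0] mult_right_mono[OF sum_le_R[OF \<open>n \<le> m\<close>] Ef] by linarith
    have c: "(c m)\<^sup>2 \<le> R n"
    proof -
      have "(c m)\<^sup>2 \<le> (\<Sum>k=n..<Suc m. (c k)\<^sup>2)" using step by (simp add: sum_nonneg)
      then show ?thesis using sum_le_R[of n "Suc m"] step by linarith
    qed
    have c4: "c m ^ 4 = (c m)\<^sup>2 * (c m)\<^sup>2" by (simp add: power2_eq_square power4_eq_xxxx)
    have "expectation (\<lambda>\<omega>. f \<omega> * (Y (Suc m) \<omega> - Y n \<omega>) ^ 4) \<le>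
      expectation (\<lambda>\<omega>. f \<omega> * (Y m \<omega> - Y n \<omega>) ^ 4)
      + 8 * (c m)\<^sup>2 * expectation (\<lambda>\<omega>. f \<omega> * (Y m \<omega> - Y n \<omega>)\<^sup>2) + 3 * c m ^ 4 * expectation f"
      using fourth_power_step[OF fm f0, of "\<lambda>\<omega>. Y m \<omega> - Y n \<omega>"] step bounded_le by auto
    also have "\<dots> \<le> 11 * R n * (\<Sum>k=n..<m. (c k)\<^sup>2) * expectation f
        + 8 * (c m)\<^sup>2 * (R n * expectation f) + 3 * ((c m)\<^sup>2 * R n) * expectation f"
      unfolding c4 using step.IH D c Ef by (intro add_mono mult_left_mono mult_right_mono) auto
    also have "\<dots> = 11 * R n * (\<Sum>k=n..<Suc m. (c k)\<^sup>2) * expectation f"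
      using step by (simp add: algebra_simps)
    finally show ?case .
  qed auto
  also have "\<dots> \<le> 11 * R n * R n * expectation f"
    using sum_le_R[OF \<open>n \<le> m\<close>] Ef R_pos[of n] by (intro mult_right_mono mult_left_mono) auto
  finally show ?thesis by (simp add: power2_eq_square)
qed

definition Y_lim :: "'a \<Rightarrow> real" where "Y_lim \<omega> = lim (\<lambda>n. Y n \<omega>)"

lemma Y_lim_measurable [measurable]: "Y_lim \<in> borel_measurable M"
  unfolding Y_lim_def[abs_def] using bounded_at_measurable_M[OF bounded] by measurable

lemma tendsto_Y_lim: "AE \<omega> in M. (\<lambda>n. Y n \<omega>) \<longlonglongrightarrow> Y_lim \<omega>"
  using converges by eventually_elim (simp add: Y_lim_def convergent_LIMSEQ_iff)

end

section \<open>The limit of a nondegenerate martingale\<close>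

locale nondegenerate_martingale = bounded_martingale +
  fixes v :: real
  assumes v_range: "0 < v" "v \<le> 1"
    and variance: "\<And>n f. bounded_at n f \<Longrightarrow> (\<And>\<omega>. 0 \<le> f \<omega>) \<Longrightarrow>
      v * (c n)\<^sup>2 * expectation f \<le> expectation (\<lambda>\<omega>. f \<omega> * (\<xi> n \<omega>)\<^sup>2)"
begin

lemma square_lower_bound:
  assumes "n \<le> m" and f: "bounded_at n f" and f0: "\<And>\<omega>. 0 \<le> f \<omega>"
  shows "expectation (\<lambda>\<omega>. f \<omega> * (Y n \<omega>)\<^sup>2) + v * (\<Sum>k=n..<m. (c k)\<^sup>2) * expectation f
         \<le> expectation (\<lambda>\<omega>. f \<omega> * (Y m \<omega>)\<^sup>2)"
  using \<open>n \<le> m\<close>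
proof (induction m rule: dec_induct)
  case (step m)
  have fm: "bounded_at m f" using bounded_at_mono f step by blast
  have "expectation (\<lambda>\<omega>. f \<omega> * (Y (Suc m) \<omega>)\<^sup>2) =
    expectation (\<lambda>\<omega>. f \<omega> * (Y m \<omega>)\<^sup>2) + expectation (\<lambda>\<omega>. f \<omega> * (\<xi> m \<omega>)\<^sup>2)"
    using square_step[OF fm bounded[of m]] by simp
  moreover have "v * (\<Sum>k=n..<Suc m. (c k)\<^sup>2) * expectation f =
    v * (\<Sum>k=n..<m. (c k)\<^sup>2) * expectation f + v * (c m)\<^sup>2 * expectation f"
    using step by (simp add: algebra_simps)
  ultimately show ?case using step.IH variance[OF fm f0] by linarith
qed auto

text \<open>
A conditional Paley--Zygmund inequality: read for all weights \<open>f\<close>, it says that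
\<open>P(Y_lim \<noteq> 0 | past)\<close> is at least \<open>v\<^sup>2 / 176\<close>. From \<open>1 \<ge> 2 x - x\<^sup>2\<close> with \<open>x = t Y\<^sup>2\<close>, where
the factor \<open>t\<close> may depend on the past, one gets a lower bound through the second and fourth
moments of \<open>Y m\<close>. The choice \<open>t = \<theta> / (R n + (Y n)\<^sup>2)\<close> makes both terms comparable
to constants whatever the value of \<open>Y n\<close>. To pass to the limit \<open>m \<rightarrow> \<infinity>\<close> the indicator is
replaced by the continuous function \<open>h\<close>, at the price of the term with \<open>\<eta>\<close>.
\<close>

lemma weighted_limit_nonzero:
  assumes f: "bounded_at n f" and f0: "\<And>\<omega>. 0 \<le> f \<omega>"
  shows "v\<^sup>2 / 176 * expectation f \<le> expectation (\<lambda>\<omega>. f \<omega> * indicator {\<omega>. Y_lim \<omega> \<noteq> 0} \<omega>)"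
proof -
  \<comment> \<open>these choices make \<open>2 \<theta> v - 88 \<theta>\<^sup>2 - 2 \<theta> \<eta>\<^sup>2 / R n\<close>, the final bound, a positive multiple of \<open>v\<^sup>2\<close>\<close>
  define \<theta> where "\<theta> = v / 176"
  define \<eta> where "\<eta> = sqrt (R n * v / 8)"
  define t where "t \<omega> = \<theta> / (R n + (Y n \<omega>)\<^sup>2)" for \<omega>
  define h where "h y = min 1 (\<bar>y\<bar> / \<eta>)" for y :: real
  have R0: "R n > 0" by (rule R_pos)
  have \<theta>0: "\<theta> > 0" using v_range by (simp add: \<theta>_def)
  have \<eta>0: "\<eta> > 0" and \<eta>2: "\<eta>\<^sup>2 = R n * v / 8" using R0 v_range by (auto simp: \<eta>_def)
  have den: "R n + (Y n \<omega>)\<^sup>2 \<ge> R n" for \<omega> by simp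
  have t0: "0 \<le> t \<omega>" for \<omega> unfolding t_def using \<theta>0 R0 by simp
  have t_le: "t \<omega> \<le> \<theta> / R n" for \<omega>
    unfolding t_def using \<theta>0 R0 by (intro divide_left_mono) (auto intro!: mult_pos_pos add_pos_nonneg)
  have tB: "bounded_at n t"
  proof (rule bounded_atI)
    show "t \<in> borel_measurable (F n)"
      unfolding t_def[abs_def] using bounded_at_measurable[OF bounded[of n]] by measurable
    show "AE \<omega> in M. \<bar>t \<omega>\<bar> \<le> \<theta> / R n" using t0 t_le by simp
  qed
  have Ef: "0 \<le> expectation f" using f0 by simp
  have h_lower: "2 * (t \<omega> * y\<^sup>2) - (t \<omega>)\<^sup>2 * y ^ 4 - 2 * \<theta> * \<eta>\<^sup>2 / R n \<le> h y" for \<omega> y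
  proof (cases "\<eta> \<le> \<bar>y\<bar>")
    case True
    have "0 \<le> (1 - t \<omega> * y\<^sup>2)\<^sup>2" by simp
    also have "\<dots> = 1 - 2 * (t \<omega> * y\<^sup>2) + (t \<omega>)\<^sup>2 * y ^ 4"
      by (simp add: power2_eq_square power4_eq_xxxx algebra_simps)
    finally have "2 * (t \<omega> * y\<^sup>2) - (t \<omega>)\<^sup>2 * y ^ 4 \<le> 1" by simp
    moreover have "h y = 1" using True \<eta>0 by (simp add: h_def min_def)
    moreover have "0 \<le> 2 * \<theta> * \<eta>\<^sup>2 / R n" using \<theta>0 R0 by simp
    ultimately show ?thesis by linarith
  next
    case False
    then have "y\<^sup>2 \<le> \<eta>\<^sup>2" by (simp add: abs_le_square_iff[symmetric])
    then have "t \<omega> * y\<^sup>2 \<le> \<theta> / R n * \<eta>\<^sup>2" using t_le t0 \<theta>0 R0 by (intro mult_mono) auto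
    moreover have "0 \<le> (t \<omega>)\<^sup>2 * y ^ 4" "0 \<le> h y" using \<eta>0 by (auto simp: h_def)
    moreover have "2 * \<theta> * \<eta>\<^sup>2 / R n = 2 * (\<theta> / R n * \<eta>\<^sup>2)" by simp
    ultimately show ?thesis by linarith
  qed
  have lower: "(2 * \<theta> * v * (\<Sum>k=n..<m. (c k)\<^sup>2) / R n - 88 * \<theta>\<^sup>2 - 2 * \<theta> * \<eta>\<^sup>2 / R n) * expectation f
      \<le> expectation (\<lambda>\<omega>. f \<omega> * h (Y m \<omega>))" if "n \<le> m" for m

  proof -
    define s where "s = (\<Sum>k=n..<m. (c k)\<^sup>2)"
    have s: "0 \<le> s" "s \<le> R n" using sum_le_R[OF that] by (auto simp: s_def intro: sum_nonneg)
    have m: "bounded_at m f" "bounded_at m t" "bounded_at m (Y n)" "bounded_at m (Y m)"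
      using that f tB bounded bounded_at_mono by blast+
    define K where "K = 2 * \<theta> * \<eta>\<^sup>2 / R n"
    have hB: "bounded_at m (\<lambda>\<omega>. h (Y m \<omega>))"
    proof (rule bounded_atI)
      show "(\<lambda>\<omega>. h (Y m \<omega>)) \<in> borel_measurable (F m)"
        unfolding h_def using bounded_at_measurable[OF bounded[of m]] by measurable
      show "AE \<omega> in M. \<bar>h (Y m \<omega>)\<bar> \<le> 1" using \<eta>0 by (simp add: h_def)
    qed
    have square: "expectation (\<lambda>\<omega>. (f \<omega> * t \<omega>) * (Y n \<omega>)\<^sup>2) + v * s * expectation (\<lambda>\<omega>. f \<omega> * t \<omega>)
        \<le> expectation (\<lambda>\<omega>. (f \<omega> * t \<omega>) * (Y m \<omega>)\<^sup>2)"
      unfolding s_def using f tB f0 t0 by (intro square_lower_bound that) auto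
    \<comment> \<open>\<open>Y m\<close> is split into \<open>Y n\<close> and the fluctuation after \<open>n\<close>, by convexity of the fourth power\<close>
    have fourth: "expectation (\<lambda>\<omega>. (f \<omega> * (t \<omega>)\<^sup>2) * (Y m \<omega>) ^ 4)
        \<le> 8 * expectation (\<lambda>\<omega>. (f \<omega> * (t \<omega>)\<^sup>2) * (Y n \<omega>) ^ 4)
          + 88 * (R n)\<^sup>2 * expectation (\<lambda>\<omega>. f \<omega> * (t \<omega>)\<^sup>2)"
    proof -
      have pw: "(x + y) ^ 4 \<le> 8 * x ^ 4 + 8 * y ^ 4" for x y :: real
      proof -
        have sq: "(a + b)\<^sup>2 \<le> 2 * a\<^sup>2 + 2 * b\<^sup>2" for a b :: real
          using sum_squares_bound[of a b] by (simp add: power2_eq_square algebra_simps)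
        have "(x + y) ^ 4 = ((x + y)\<^sup>2)\<^sup>2" by simp
        also have "\<dots> \<le> (2 * x\<^sup>2 + 2 * y\<^sup>2)\<^sup>2" using sq by (intro power_mono) auto
        also have "\<dots> \<le> 2 * (2 * x\<^sup>2)\<^sup>2 + 2 * (2 * y\<^sup>2)\<^sup>2" by (rule sq)
        finally show ?thesis by (simp add: power_mult_distrib)
      qed
      have "expectation (\<lambda>\<omega>. (f \<omega> * (t \<omega>)\<^sup>2) * (Y m \<omega>) ^ 4) \<le>
        expectation (\<lambda>\<omega>. 8 * ((f \<omega> * (t \<omega>)\<^sup>2) * (Y n \<omega>) ^ 4) + 8 * ((f \<omega> * (t \<omega>)\<^sup>2) * (Y m \<omega> - Y n \<omega>) ^ 4))"
      proof (intro integral_mono bounded_at_integrable[of m])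
        show "(f \<omega> * (t \<omega>)\<^sup>2) * (Y m \<omega>) ^ 4 \<le>
          8 * ((f \<omega> * (t \<omega>)\<^sup>2) * (Y n \<omega>) ^ 4) + 8 * ((f \<omega> * (t \<omega>)\<^sup>2) * (Y m \<omega> - Y n \<omega>) ^ 4)" for \<omega>
          using mult_left_mono[OF pw[of "Y n \<omega>" "Y m \<omega> - Y n \<omega>"], of "f \<omega> * (t \<omega>)\<^sup>2"] f0[of \<omega>]
          by (simp add: algebra_simps)
      qed (use m in auto)
      also have "\<dots> = expectation (\<lambda>\<omega>. 8 * ((f \<omega> * (t \<omega>)\<^sup>2) * (Y n \<omega>) ^ 4))
          + expectation (\<lambda>\<omega>. 8 * ((f \<omega> * (t \<omega>)\<^sup>2) * (Y m \<omega> - Y n \<omega>) ^ 4))"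
        using m by (intro Bochner_Integration.integral_add bounded_at_integrable[of m]) auto
      also have "\<dots> \<le> 8 * expectation (\<lambda>\<omega>. (f \<omega> * (t \<omega>)\<^sup>2) * (Y n \<omega>) ^ 4)
          + 8 * (11 * (R n)\<^sup>2 * expectation (\<lambda>\<omega>. f \<omega> * (t \<omega>)\<^sup>2))"
        using fourth_power_deviation[OF that, of "\<lambda>\<omega>. f \<omega> * (t \<omega>)\<^sup>2"] f tB f0
        by (simp add: bounded_at_mult bounded_at_power)
      finally show ?thesis by simp
    qed
    have "(2 * \<theta> * v * s / R n - 88 * \<theta>\<^sup>2) * expectation f = expectation (\<lambda>\<omega>. (2 * \<theta> * v * s / R n - 88 * \<theta>\<^sup>2) * f \<omega>)"
      by simp
    also have "\<dots> \<le> expectation (\<lambda>\<omega>. 2 * ((f \<omega> * t \<omega>) * (Y n \<omega>)\<^sup>2) + 2 * v * s * (f \<omega> * t \<omega>)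
        - (8 * ((f \<omega> * (t \<omega>)\<^sup>2) * (Y n \<omega>) ^ 4) + 88 * (R n)\<^sup>2 * (f \<omega> * (t \<omega>)\<^sup>2)))"
    proof (intro integral_mono bounded_at_integrable[of m])
      fix \<omega>
      define y where "y = (Y n \<omega>)\<^sup>2"
      have y0: "0 \<le> y" by (simp add: y_def)
      have "R n + y \<noteq> 0" using R0 y0 by simp
      then have T: "t \<omega> * (y + R n) = \<theta>" by (simp add: t_def y_def add.commute)
      have vs: "v * s / R n \<le> 1"
        using mult_mono[of v 1 s "R n"] v_range s R0 by (simp add: divide_le_eq)
      have "\<theta> * (v * s / R n) = t \<omega> * (y * (v * s / R n) + v * s)"
        using R0 by (simp add: T[symmetric] field_simps)
      also have "\<dots> \<le> t \<omega> * (y * 1 + v * s)" using vs y0 t0 v_range s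
        by (intro mult_left_mono add_mono) auto
      finally have "2 * (\<theta> * (v * s / R n)) \<le> 2 * (t \<omega> * (y * 1 + v * s))" by simp
      then have A: "2 * \<theta> * v * s / R n \<le> 2 * (t \<omega> * y) + 2 * v * s * t \<omega>"
        by (simp add: distrib_left mult.assoc mult.left_commute mult.commute)
      have "(t \<omega>)\<^sup>2 * (8 * y\<^sup>2 + 88 * (R n)\<^sup>2) \<le> (t \<omega>)\<^sup>2 * (88 * (y + R n)\<^sup>2)"
      proof (rule mult_left_mono)
        have "0 \<le> 80 * y\<^sup>2 + 176 * (y * R n)" using y0 R0 by simp
        then show "8 * y\<^sup>2 + 88 * (R n)\<^sup>2 \<le> 88 * (y + R n)\<^sup>2"
          by (simp add: power2_eq_square algebra_simps)
      qed simp
      also have "\<dots> = 88 * \<theta>\<^sup>2" by (simp add: T[symmetric] power_mult_distrib)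
      finally have B: "(t \<omega>)\<^sup>2 * (8 * y\<^sup>2 + 88 * (R n)\<^sup>2) \<le> 88 * \<theta>\<^sup>2" .
      have "(2 * \<theta> * v * s / R n - 88 * \<theta>\<^sup>2) * f \<omega> \<le>
        (2 * (t \<omega> * y) + 2 * v * s * t \<omega> - (t \<omega>)\<^sup>2 * (8 * y\<^sup>2 + 88 * (R n)\<^sup>2)) * f \<omega>"
        using A B f0[of \<omega>] by (intro mult_right_mono) auto
      moreover have "y\<^sup>2 = Y n \<omega> ^ 4" by (simp add: y_def)
      ultimately show "(2 * \<theta> * v * s / R n - 88 * \<theta>\<^sup>2) * f \<omega> \<le>
        2 * ((f \<omega> * t \<omega>) * (Y n \<omega>)\<^sup>2) + 2 * v * s * (f \<omega> * t \<omega>)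
        - (8 * ((f \<omega> * (t \<omega>)\<^sup>2) * (Y n \<omega>) ^ 4) + 88 * (R n)\<^sup>2 * (f \<omega> * (t \<omega>)\<^sup>2))"
        by (simp add: y_def[symmetric] algebra_simps)
    qed (use m in auto)
    also have "\<dots> = 2 * expectation (\<lambda>\<omega>. (f \<omega> * t \<omega>) * (Y n \<omega>)\<^sup>2) + 2 * v * s * expectation (\<lambda>\<omega>. f \<omega> * t \<omega>)
        - (8 * expectation (\<lambda>\<omega>. (f \<omega> * (t \<omega>)\<^sup>2) * (Y n \<omega>) ^ 4)
           + 88 * (R n)\<^sup>2 * expectation (\<lambda>\<omega>. f \<omega> * (t \<omega>)\<^sup>2))"
    proof -
      have "bounded_at m (\<lambda>\<omega>. 2 * ((f \<omega> * t \<omega>) * (Y n \<omega>)\<^sup>2))" "bounded_at m (\<lambda>\<omega>. 2 * v * s * (f \<omega> * t \<omega>))"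
        "bounded_at m (\<lambda>\<omega>. 8 * ((f \<omega> * (t \<omega>)\<^sup>2) * (Y n \<omega>) ^ 4))"
        "bounded_at m (\<lambda>\<omega>. 88 * (R n)\<^sup>2 * (f \<omega> * (t \<omega>)\<^sup>2))"
        using m by auto
      note i = this[THEN bounded_at_integrable]
      show ?thesis
        using i by (simp only: Bochner_Integration.integral_diff Bochner_Integration.integral_add
            Bochner_Integration.integrable_add Bochner_Integration.integral_mult_right_zero)
    qed
    also have "\<dots> \<le> 2 * expectation (\<lambda>\<omega>. (f \<omega> * t \<omega>) * (Y m \<omega>)\<^sup>2)
        - expectation (\<lambda>\<omega>. (f \<omega> * (t \<omega>)\<^sup>2) * (Y m \<omega>) ^ 4)"
      using square fourth by linarith
    also have "\<dots> = expectation (\<lambda>\<omega>. 2 * ((f \<omega> * t \<omega>) * (Y m \<omega>)\<^sup>2) - (f \<omega> * (t \<omega>)\<^sup>2) * (Y m \<omega>) ^ 4)"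
      using m by (subst Bochner_Integration.integral_diff) (auto intro!: bounded_at_integrable[of m])
    also have "\<dots> \<le> expectation (\<lambda>\<omega>. f \<omega> * h (Y m \<omega>) + K * f \<omega>)"
    proof (intro integral_mono bounded_at_integrable[of m])
      fix \<omega>
      have "f \<omega> * (2 * (t \<omega> * (Y m \<omega>)\<^sup>2) - (t \<omega>)\<^sup>2 * (Y m \<omega>) ^ 4) \<le> f \<omega> * (h (Y m \<omega>) + K)"
        using h_lower[of \<omega> "Y m \<omega>"] by (intro mult_left_mono f0) (simp add: K_def)
      then show "2 * ((f \<omega> * t \<omega>) * (Y m \<omega>)\<^sup>2) - (f \<omega> * (t \<omega>)\<^sup>2) * (Y m \<omega>) ^ 4 \<le> f \<omega> * h (Y m \<omega>) + K * f \<omega>"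
        by (simp add: algebra_simps)
    qed (use m hB in auto)
    also have "\<dots> = expectation (\<lambda>\<omega>. f \<omega> * h (Y m \<omega>)) + K * expectation f"
      using m hB by (subst Bochner_Integration.integral_add) (auto intro!: bounded_at_integrable[of m])
    finally show ?thesis by (simp add: K_def s_def algebra_simps)
  qed
  have "(\<lambda>m. \<Sum>k=n..<m. (c k)\<^sup>2) \<longlonglongrightarrow> R n"
  proof (rule LIMSEQ_offset[where k = n])
    have "(\<Sum>k=n..<m + n. (c k)\<^sup>2) = (\<Sum>k<m. (c (k + n))\<^sup>2)" for m
      using sum.shift_bounds_nat_ivl[of "\<lambda>k. (c k)\<^sup>2" 0 n m] by (simp add: lessThan_atLeast0)
    then show "(\<lambda>m. \<Sum>k=n..<m + n. (c k)\<^sup>2) \<longlonglongrightarrow> R n"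
      unfolding R_def using summable_LIMSEQ[of "\<lambda>k. (c (k + n))\<^sup>2"] c_summable
      by (simp add: summable_iff_shift[of "\<lambda>n. (c n)\<^sup>2"])
  qed
  then have "(\<lambda>m. (2 * \<theta> * v * (\<Sum>k=n..<m. (c k)\<^sup>2) / R n - 88 * \<theta>\<^sup>2 - 2 * \<theta> * \<eta>\<^sup>2 / R n) * expectation f)
    \<longlonglongrightarrow> (2 * \<theta> * v * R n / R n - 88 * \<theta>\<^sup>2 - 2 * \<theta> * \<eta>\<^sup>2 / R n) * expectation f"
    by (intro tendsto_intros) (use R0 in auto)
  moreover have "(\<lambda>m. expectation (\<lambda>\<omega>. f \<omega> * h (Y m \<omega>))) \<longlonglongrightarrow> expectation (\<lambda>\<omega>. f \<omega> * h (Y_lim \<omega>))"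
  proof (rule integral_dominated_convergence)
    note [measurable] = bounded_at_measurable_M[OF f] bounded_at_measurable_M[OF bounded]
    show "(\<lambda>\<omega>. f \<omega> * h (Y_lim \<omega>)) \<in> borel_measurable M" "(\<lambda>\<omega>. f \<omega> * h (Y m \<omega>)) \<in> borel_measurable M" for m
      unfolding h_def by measurable
    show "integrable M f" using f by (rule bounded_at_integrable)
    show "AE \<omega> in M. (\<lambda>m. f \<omega> * h (Y m \<omega>)) \<longlonglongrightarrow> f \<omega> * h (Y_lim \<omega>)"
      using tendsto_Y_lim unfolding h_def by eventually_elim (intro tendsto_intros, use \<eta>0 in auto)
    show "AE \<omega> in M. norm (f \<omega> * h (Y m \<omega>)) \<le> f \<omega>" for m
      using f0 \<eta>0 by (auto simp: abs_mult h_def intro!: mult_left_le)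
  qed
  ultimately have "(2 * \<theta> * v * R n / R n - 88 * \<theta>\<^sup>2 - 2 * \<theta> * \<eta>\<^sup>2 / R n) * expectation f \<le> expectation (\<lambda>\<omega>. f \<omega> * h (Y_lim \<omega>))"
    using lower by (intro LIMSEQ_le) auto
  moreover have "v\<^sup>2 / 176 \<le> 2 * \<theta> * v * R n / R n - 88 * \<theta>\<^sup>2 - 2 * \<theta> * \<eta>\<^sup>2 / R n"
    unfolding \<eta>2 using R0 by (simp add: \<theta>_def power2_eq_square field_simps)
  ultimately have "v\<^sup>2 / 176 * expectation f \<le> expectation (\<lambda>\<omega>. f \<omega> * h (Y_lim \<omega>))"
    by (meson Ef mult_right_mono order_trans)
  also have "\<dots> \<le> expectation (\<lambda>\<omega>. f \<omega> * indicator {\<omega>. Y_lim \<omega> \<noteq> 0} \<omega>)"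
  proof (intro integral_mono)
    note [measurable] = bounded_at_measurable_M[OF f]
    have int: "integrable M (\<lambda>\<omega>. f \<omega> * g \<omega>)"
      if [measurable]: "g \<in> borel_measurable M" and g: "\<And>\<omega>. 0 \<le> g \<omega> \<and> g \<omega> \<le> 1" for g
      using bounded_at_integrable[OF f]
      by (rule Bochner_Integration.integrable_bound) (use f0 g in \<open>auto simp: abs_mult intro!: mult_left_le\<close>)
    show "integrable M (\<lambda>\<omega>. f \<omega> * h (Y_lim \<omega>))" using \<eta>0 by (intro int) (auto simp: h_def)
    have "indicator {\<omega>. Y_lim \<omega> \<noteq> 0} = (\<lambda>\<omega>. if Y_lim \<omega> = 0 then 0 else 1 :: real)" by auto
    then show "integrable M (\<lambda>\<omega>. f \<omega> * indicator {\<omega>. Y_lim \<omega> \<noteq> 0} \<omega>)"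
      by (intro int) (auto simp: indicator_def)
    show "f \<omega> * h (Y_lim \<omega>) \<le> f \<omega> * indicator {\<omega>. Y_lim \<omega> \<noteq> 0} \<omega>" for \<omega>
      using f0 \<eta>0 by (intro mult_left_mono) (auto simp: h_def indicator_def)
  qed
  finally show ?thesis .
qed

text \<open>
The previous bound is used with the weight \<open>max 0 (1 - k \<bar>Y n\<bar>)\<close>, which is concentrated where the
martingale is within \<open>1 / k\<close> of \<open>0\<close>. As \<open>n \<rightarrow> \<infinity>\<close>, it bounds a multiple of \<open>P(Y_lim = 0)\<close> by the
expectation of \<open>max 0 (1 - k \<bar>Y_lim\<bar>)\<close> over \<open>Y_lim \<noteq> 0\<close>, which vanishes as \<open>k \<rightarrow> \<infinity>\<close>. This
takes the place of the zero-one law of Levy.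
\<close>

theorem limit_nonzero: "AE \<omega> in M. Y_lim \<omega> \<noteq> 0"
proof -
  define I where "I \<omega> = (indicator {\<omega>. Y_lim \<omega> \<noteq> 0} \<omega> :: real)" for \<omega>
  have [measurable]: "I \<in> borel_measurable M"
  proof -
    have "I = (\<lambda>\<omega>. if Y_lim \<omega> = 0 then 0 else 1)" by (auto simp: I_def)
    then show ?thesis by simp
  qed
  define g where "g \<delta> y = max 0 (1 - \<delta> * \<bar>y\<bar>)" for \<delta> y :: real
  have g01: "0 \<le> g \<delta> y \<and> g \<delta> y \<le> 1" if "0 \<le> \<delta>" for \<delta> y using that by (auto simp: g_def)
  note [measurable] = bounded_at_measurable_M[OF bounded]
  define B where "B = {\<omega> \<in> space M. Y_lim \<omega> = 0}"
  have [measurable]: "B \<in> sets M" unfolding B_def by measurable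
  have step: "v\<^sup>2 / 176 * prob B \<le> expectation (\<lambda>\<omega>. g (real k) (Y_lim \<omega>) * I \<omega>)" for k
  proof -
    have conv: "(\<lambda>n. expectation (\<lambda>\<omega>. g (real k) (Y n \<omega>) * W \<omega>)) \<longlonglongrightarrow> expectation (\<lambda>\<omega>. g (real k) (Y_lim \<omega>) * W \<omega>)"
      if [measurable]: "W \<in> borel_measurable M" and W: "\<And>\<omega>. 0 \<le> W \<omega> \<and> W \<omega> \<le> 1" for W
    proof (rule integral_dominated_convergence)
      show "AE \<omega> in M. (\<lambda>n. g (real k) (Y n \<omega>) * W \<omega>) \<longlonglongrightarrow> g (real k) (Y_lim \<omega>) * W \<omega>"
        using tendsto_Y_lim unfolding g_def by eventually_elim (intro tendsto_intros)
      show "AE \<omega> in M. norm (g (real k) (Y n \<omega>) * W \<omega>) \<le> 1" for n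
        using g01[of "real k"] W by (auto simp: abs_mult intro!: mult_le_one)
    qed (auto simp: g_def)
    have ineq: "v\<^sup>2 / 176 * expectation (\<lambda>\<omega>. g (real k) (Y n \<omega>) * 1) \<le> expectation (\<lambda>\<omega>. g (real k) (Y n \<omega>) * I \<omega>)" for n
      unfolding I_def mult_1_right
    proof (rule weighted_limit_nonzero)
      show "bounded_at n (\<lambda>\<omega>. g (real k) (Y n \<omega>))"
      proof (rule bounded_atI)
        show "(\<lambda>\<omega>. g (real k) (Y n \<omega>)) \<in> borel_measurable (F n)"
          unfolding g_def using bounded_at_measurable[OF bounded[of n]] by measurable
        show "AE \<omega> in M. \<bar>g (real k) (Y n \<omega>)\<bar> \<le> 1" using g01[of "real k"] by simp
      qed
      show "0 \<le> g (real k) (Y n \<omega>)" for \<omega> by (simp add: g_def)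
    qed
    have "v\<^sup>2 / 176 * expectation (\<lambda>\<omega>. g (real k) (Y_lim \<omega>) * 1) \<le> expectation (\<lambda>\<omega>. g (real k) (Y_lim \<omega>) * I \<omega>)"
      using ineq by (intro LIMSEQ_le[OF tendsto_mult[OF tendsto_const conv] conv]) (auto simp: I_def indicator_def)
    moreover have "prob B \<le> expectation (\<lambda>\<omega>. g (real k) (Y_lim \<omega>) * 1)"
    proof -
      have "expectation (indicator B) \<le> expectation (\<lambda>\<omega>. g (real k) (Y_lim \<omega>) * 1)"
      proof (intro integral_mono)
        show "integrable M (\<lambda>\<omega>. g (real k) (Y_lim \<omega>) * 1)"
          using g01[of "real k"] by (intro integrable_const_bound[where B = 1]) (auto simp: g_def)
        show "indicator B \<omega> \<le> g (real k) (Y_lim \<omega>) * 1" for \<omega>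
          using g01[of "real k" "Y_lim \<omega>"] by (auto simp: B_def indicator_def g_def)
      qed (simp add: integrable_real_indicator emeasure_eq_measure)
      then show ?thesis by simp
    qed
    ultimately show ?thesis
      using mult_left_mono[of "prob B" "expectation (\<lambda>\<omega>. g (real k) (Y_lim \<omega>) * 1)" "v\<^sup>2 / 176"] by simp
  qed
  have "(\<lambda>k. expectation (\<lambda>\<omega>. g (real k) (Y_lim \<omega>) * I \<omega>)) \<longlonglongrightarrow> expectation (\<lambda>\<omega>. 0)"
  proof (rule integral_dominated_convergence)
    show "AE \<omega> in M. (\<lambda>k. g (real k) (Y_lim \<omega>) * I \<omega>) \<longlonglongrightarrow> 0"
    proof (intro AE_I2)
      fix \<omega>
      have "eventually (\<lambda>k. g (real k) (Y_lim \<omega>) * I \<omega> = 0) sequentially"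
      proof (cases "Y_lim \<omega> = 0")
        case False
        have "eventually (\<lambda>k. 1 / \<bar>Y_lim \<omega>\<bar> \<le> real k) sequentially"
          using filterlim_real_sequentially by (simp add: filterlim_at_top)
        then show ?thesis
          by eventually_elim (use False in \<open>simp add: g_def field_simps\<close>)
      qed (simp add: I_def)
      then show "(\<lambda>k. g (real k) (Y_lim \<omega>) * I \<omega>) \<longlonglongrightarrow> 0" by (rule tendsto_eventually)
    qed
    show "AE \<omega> in M. norm (g (real k) (Y_lim \<omega>) * I \<omega>) \<le> 1" for k
      using g01[of "real k"] by (auto simp: I_def indicator_def)
  qed (auto simp: g_def)
  then have "v\<^sup>2 / 176 * prob B \<le> 0" using step by (intro LIMSEQ_le_const) auto
  then have "prob B = 0" using v_range by (simp add: mult_le_0_iff measure_le_0_iff)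
  then have "AE \<omega> in M. \<omega> \<notin> B" by (intro AE_not_in) (auto simp: null_sets_def emeasure_eq_measure)
  then show ?thesis using AE_space by eventually_elim (auto simp: B_def)
qed

end

section \<open>The ruin of positive supermartingales\<close>

text \<open>
Gambler's ruin. Fix a starting time \<open>n\<close> and a level \<open>K\<close>; \<open>G j\<close> says that the process has stayed
inside \<open>(0, K)\<close> up to time \<open>n + j\<close>, and \<open>H j\<close> that it has left this interval through \<open>K\<close>.
The supermartingale property, applied up to the exit time, gives \<open>K P(H j) \<le> E \<bar>Y n\<bar>\<close>. The
stopped square is bounded by \<open>(K + 1)\<^sup>2\<close>, the overshoot being at most \<open>1\<close>, but its expectation
grows by at least \<open>w P(G j)\<close> in each step that is late enough; as \<open>w\<close> is not summable, staying in the interval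
forever has probability \<open>0\<close>. So staying positive forever has probability at most \<open>E \<bar>Y n\<bar> / K\<close>
for every \<open>K\<close>.
\<close>

lemma (in filtered_prob_space) supermartingale_not_eventually_positive:
  fixes Y :: "nat \<Rightarrow> 'w \<Rightarrow> real" and w :: "nat \<Rightarrow> real"
  assumes bounded: "\<And>n. bounded_at n (Y n)"
    and step: "\<And>n. AE \<omega> in M. 0 < Y n \<omega> \<longrightarrow> 0 \<le> Y (Suc n) \<omega> \<and> Y (Suc n) \<omega> \<le> Y n \<omega> + 1"
    and super: "\<And>n A. A \<in> sets (F n) \<Longrightarrow> (\<And>\<omega>. \<omega> \<in> A \<Longrightarrow> 0 < Y n \<omega>) \<Longrightarrow>
      expectation (\<lambda>\<omega>. indicator A \<omega> * Y (Suc n) \<omega>) \<le> expectation (\<lambda>\<omega>. indicator A \<omega> * Y n \<omega>)"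
    and w: "\<And>n. 0 \<le> w n" "\<not> summable w"
    and variance: "\<And>K. \<forall>\<^sub>F n in sequentially. \<forall>A\<in>sets (F n). (\<forall>\<omega>\<in>A. 0 < Y n \<omega> \<and> Y n \<omega> < K) \<longrightarrow>
      expectation (\<lambda>\<omega>. indicator A \<omega> * (Y n \<omega>)\<^sup>2) + w n * prob A
      \<le> expectation (\<lambda>\<omega>. indicator A \<omega> * (Y (Suc n) \<omega>)\<^sup>2)"
  shows "AE \<omega> in M. \<not> (\<forall>\<^sub>F n in sequentially. 0 < Y n \<omega>)"
proof -
  note [measurable] = bounded_at_measurable_M[OF bounded]
  have bounded_le: "bounded_at n (Y m)" if "m \<le> n" for m n
    using bounded_at_mono[OF that bounded] .
  have "AE \<omega> in M. \<not> (\<forall>k\<ge>n. 0 < Y k \<omega>)" for n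
  proof -
    define A where "A = {\<omega> \<in> space M. \<forall>k\<ge>n. 0 < Y k \<omega>}"
    have [measurable]: "A \<in> sets M" unfolding A_def by measurable
    have "K * prob A \<le> expectation (\<lambda>\<omega>. \<bar>Y n \<omega>\<bar>)" if "K > 0" for K
    proof -
      define G where "G j = {\<omega> \<in> space M. \<forall>i\<le>j. 0 < Y (n + i) \<omega> \<and> Y (n + i) \<omega> < K}" for j
      define H where "H j = {\<omega> \<in> space M. \<exists>i\<le>j. K \<le> Y (n + i) \<omega> \<and> (\<forall>l<i. 0 < Y (n + l) \<omega> \<and> Y (n + l) \<omega> < K)}" for j
      have [measurable]: "G j \<in> sets M" "H j \<in> sets M" for j
        unfolding G_def H_def by measurable
      have G_F: "G j \<in> sets (F (n + j))" for j
      proof -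
        have "{\<omega> \<in> space (F (n + j)). \<forall>i\<in>{..j}. 0 < Y (n + i) \<omega> \<and> Y (n + i) \<omega> < K} \<in> sets (F (n + j))"
        proof (intro sets.sets_Collect_finite_All)
          fix i assume "i \<in> {..j}"
          then have [measurable]: "Y (n + i) \<in> borel_measurable (F (n + j))"
            using bounded_le[of "n + i" "n + j"] by (simp add: bounded_at_measurable)
          show "{\<omega> \<in> space (F (n + j)). 0 < Y (n + i) \<omega> \<and> Y (n + i) \<omega> < K} \<in> sets (F (n + j))"
            by measurable
        qed simp
        then show ?thesis unfolding G_def space_F Ball_def atMost_iff .
      qed
      have G_Suc: "\<omega> \<in> G (Suc j) \<longleftrightarrow> \<omega> \<in> G j \<and> 0 < Y (Suc (n + j)) \<omega> \<and> Y (Suc (n + j)) \<omega> < K" for \<omega> j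
      proof -
        have all: "(\<forall>i\<le>Suc j. P i) \<longleftrightarrow> (\<forall>i\<le>j. P i) \<and> P (Suc j)" for P
          by (auto elim: le_SucE intro: le_SucI)
        show ?thesis unfolding G_def mem_Collect_eq all add_Suc_right by blast
      qed
      have H_Suc: "\<omega> \<in> H (Suc j) \<longleftrightarrow> \<omega> \<in> H j \<or> \<omega> \<in> G j \<and> K \<le> Y (Suc (n + j)) \<omega>" for \<omega> j
      proof -
        have ex: "(\<exists>i\<le>Suc j. P i) \<longleftrightarrow> (\<exists>i\<le>j. P i) \<or> P (Suc j)" for P
          by (auto elim: le_SucE intro: le_SucI)
        show ?thesis unfolding H_def G_def mem_Collect_eq ex less_Suc_eq_le add_Suc_right by blast
      qed
      have GH: "\<omega> \<notin> H j" if "\<omega> \<in> G j" for \<omega> j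
      proof
        assume "\<omega> \<in> H j"
        then obtain i where i: "i \<le> j" "K \<le> Y (n + i) \<omega>" unfolding H_def by blast
        have "Y (n + i) \<omega> < K" using that i(1) by (simp add: G_def)
        then show False using i(2) by simp
      qed
      have bG: "bounded_at (Suc (n + j)) (indicator (G j))" "bounded_at (Suc (n + j)) (indicator (G (Suc j)))" for j
        using G_F[of j] G_F[of "Suc j"] F_mono[of "n + j" "Suc (n + j)"] by auto
      have bY: "bounded_at (Suc (n + j)) (Y (Suc (n + j)))" for j using bounded .
      have iG: "integrable M (\<lambda>\<omega>. indicator (G j) \<omega> * (Y (Suc (n + j)) \<omega>) ^ k)"
        "integrable M (\<lambda>\<omega>. indicator (G (Suc j)) \<omega> * (Y (Suc (n + j)) \<omega>) ^ k)" for j k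
        using bG[of j] bY[of j] by (intro bounded_at_integrable[of "Suc (n + j)"]; auto)+
      have iH: "integrable M (indicator (H j) :: _ \<Rightarrow> real)" for j
        by (simp add: integrable_real_indicator emeasure_eq_measure)

      \<comment> \<open>the stopped process: the value \<open>K\<close> after an exit through \<open>K\<close>, the value \<open>0\<close> after an exit through \<open>0\<close>\<close>
      have linear: "K * prob (H j) + expectation (\<lambda>\<omega>. indicator (G j) \<omega> * Y (n + j) \<omega>)
          \<le> expectation (\<lambda>\<omega>. \<bar>Y n \<omega>\<bar>)" for j
      proof (induction j)
        case 0
        have i0: "integrable M (\<lambda>\<omega>. indicator (G 0) \<omega> * Y n \<omega>)"
          using G_F[of 0] bounded[of n] by (intro bounded_at_integrable[of n]) auto
        have "K * prob (H 0) + expectation (\<lambda>\<omega>. indicator (G 0) \<omega> * Y (n + 0) \<omega>)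
          = expectation (\<lambda>\<omega>. K * indicator (H 0) \<omega> + indicator (G 0) \<omega> * Y n \<omega>)"
          using i0 iH[of 0] by (subst Bochner_Integration.integral_add) auto
        also have "\<dots> \<le> expectation (\<lambda>\<omega>. \<bar>Y n \<omega>\<bar>)"
        proof (intro integral_mono)
          show "integrable M (\<lambda>\<omega>. K * indicator (H 0) \<omega> + indicator (G 0) \<omega> * Y n \<omega>)"
            using i0 iH[of 0] by auto
          show "integrable M (\<lambda>\<omega>. \<bar>Y n \<omega>\<bar>)" using bounded_at_integrable[OF bounded] by auto
          show "K * indicator (H 0) \<omega> + indicator (G 0) \<omega> * Y n \<omega> \<le> \<bar>Y n \<omega>\<bar>" for \<omega>
            using that by (auto simp: G_def H_def indicator_def)
        qed
        finally show ?case .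
      next
        case (Suc j)
        note iG' = iG[of j 1, simplified]
        have "K * prob (H (Suc j)) + expectation (\<lambda>\<omega>. indicator (G (Suc j)) \<omega> * Y (Suc (n + j)) \<omega>)
          = expectation (\<lambda>\<omega>. K * indicator (H (Suc j)) \<omega> + indicator (G (Suc j)) \<omega> * Y (Suc (n + j)) \<omega>)"
          using iG' iH[of "Suc j"] by (subst Bochner_Integration.integral_add) auto
        also have "\<dots> \<le> expectation (\<lambda>\<omega>. K * indicator (H j) \<omega> + indicator (G j) \<omega> * Y (Suc (n + j)) \<omega>)"
        proof (intro integral_mono_AE)
          show "AE \<omega> in M. K * indicator (H (Suc j)) \<omega> + indicator (G (Suc j)) \<omega> * Y (Suc (n + j)) \<omega>
              \<le> K * indicator (H j) \<omega> + indicator (G j) \<omega> * Y (Suc (n + j)) \<omega>"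
            using step[of "n + j"]
          proof eventually_elim
            case (elim \<omega>)
            have "\<omega> \<in> G j \<Longrightarrow> 0 < Y (n + j) \<omega>" by (simp add: G_def)
            then show ?case
              using elim GH[of \<omega> j] that by (auto simp: indicator_def G_Suc H_Suc)
          qed
        qed (use iG' iH[of j] iH[of "Suc j"] in auto)
        also have "\<dots> = K * prob (H j) + expectation (\<lambda>\<omega>. indicator (G j) \<omega> * Y (Suc (n + j)) \<omega>)"
          using iG' iH[of j] by (subst Bochner_Integration.integral_add) auto
        finally have "K * prob (H (Suc j)) + expectation (\<lambda>\<omega>. indicator (G (Suc j)) \<omega> * Y (Suc (n + j)) \<omega>)
          \<le> K * prob (H j) + expectation (\<lambda>\<omega>. indicator (G j) \<omega> * Y (Suc (n + j)) \<omega>)" .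
        moreover have "expectation (\<lambda>\<omega>. indicator (G j) \<omega> * Y (Suc (n + j)) \<omega>)
            \<le> expectation (\<lambda>\<omega>. indicator (G j) \<omega> * Y (n + j) \<omega>)"
          by (intro super G_F) (simp add: G_def)
        ultimately show ?case unfolding add_Suc_right using Suc.IH by linarith
      qed

      \<comment> \<open>the stopped square, with the largest possible value after an exit through \<open>K\<close>\<close>
      define q where "q j = (K + 1)\<^sup>2 * prob (H j) + expectation (\<lambda>\<omega>. indicator (G j) \<omega> * (Y (n + j) \<omega>)\<^sup>2)" for j
      have iG0: "integrable M (\<lambda>\<omega>. indicator (G j) \<omega> * (Y (n + j) \<omega>)\<^sup>2)" for j
        using G_F[of j] bounded[of "n + j"] by (intro bounded_at_integrable[of "n + j"]) auto
      have q_le: "q j \<le> (K + 1)\<^sup>2" for j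
      proof -
        have "q j = expectation (\<lambda>\<omega>. (K + 1)\<^sup>2 * indicator (H j) \<omega> + indicator (G j) \<omega> * (Y (n + j) \<omega>)\<^sup>2)"
          unfolding q_def using iG0[of j] iH[of j] by (subst Bochner_Integration.integral_add) auto
        also have "\<dots> \<le> expectation (\<lambda>_. (K + 1)\<^sup>2)"
        proof (intro integral_mono)
          show "(K + 1)\<^sup>2 * indicator (H j) \<omega> + indicator (G j) \<omega> * (Y (n + j) \<omega>)\<^sup>2 \<le> (K + 1)\<^sup>2" for \<omega>
          proof -
            have "(Y (n + j) \<omega>)\<^sup>2 \<le> (K + 1)\<^sup>2" if "\<omega> \<in> G j"
              using that by (intro power_mono) (auto simp: G_def less_imp_le intro: order.trans[OF less_imp_le])
            then show ?thesis using GH[of \<omega> j] by (auto simp: indicator_def)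
          qed
        qed (use iG0[of j] iH[of j] in auto)
        finally show ?thesis by (simp add: prob_space)
      qed
      obtain n0 where n0: "\<And>m A. m \<ge> n0 \<Longrightarrow> A \<in> sets (F m) \<Longrightarrow> (\<forall>\<omega>\<in>A. 0 < Y m \<omega> \<and> Y m \<omega> < K) \<Longrightarrow>
          expectation (\<lambda>\<omega>. indicator A \<omega> * (Y m \<omega>)\<^sup>2) + w m * prob A
          \<le> expectation (\<lambda>\<omega>. indicator A \<omega> * (Y (Suc m) \<omega>)\<^sup>2)"
        using variance[of K] unfolding eventually_sequentially by blast
      have q_Suc: "q j + w (n + j) * prob (G j) \<le> q (Suc j)" if "j \<ge> n0" for j
      proof -
        have "q j + w (n + j) * prob (G j) \<le>
          (K + 1)\<^sup>2 * prob (H j) + expectation (\<lambda>\<omega>. indicator (G j) \<omega> * (Y (Suc (n + j)) \<omega>)\<^sup>2)"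
        proof -
          have "\<forall>\<omega>\<in>G j. 0 < Y (n + j) \<omega> \<and> Y (n + j) \<omega> < K" unfolding G_def by blast
          from n0[OF _ G_F this] that show ?thesis unfolding q_def by simp
        qed
        also have "\<dots> = expectation (\<lambda>\<omega>. (K + 1)\<^sup>2 * indicator (H j) \<omega> + indicator (G j) \<omega> * (Y (Suc (n + j)) \<omega>)\<^sup>2)"
          using iG[of j 2] iH[of j] by (subst Bochner_Integration.integral_add) auto
        also have "\<dots> \<le> expectation (\<lambda>\<omega>. (K + 1)\<^sup>2 * indicator (H (Suc j)) \<omega>
            + indicator (G (Suc j)) \<omega> * (Y (Suc (n + j)) \<omega>)\<^sup>2)"
        proof (intro integral_mono_AE)
          show "AE \<omega> in M. (K + 1)\<^sup>2 * indicator (H j) \<omega> + indicator (G j) \<omega> * (Y (Suc (n + j)) \<omega>)\<^sup>2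
            \<le> (K + 1)\<^sup>2 * indicator (H (Suc j)) \<omega> + indicator (G (Suc j)) \<omega> * (Y (Suc (n + j)) \<omega>)\<^sup>2"
            using step[of "n + j"]
          proof eventually_elim
            case (elim \<omega>)
            have *: "0 < Y (n + j) \<omega>" "Y (n + j) \<omega> < K" if "\<omega> \<in> G j" using that by (auto simp: G_def)
            have "(Y (Suc (n + j)) \<omega>)\<^sup>2 \<le> (K + 1)\<^sup>2" if "\<omega> \<in> G j"
              using elim *[OF that] by (intro power_mono) auto
            then show ?case
              using elim * GH[of \<omega> j] by (auto simp: indicator_def G_Suc H_Suc not_less)
          qed
        qed (use iG[of j 2] iH[of j] iH[of "Suc j"] in auto)
        also have "\<dots> = q (Suc j)"
          unfolding q_def using iG[of j 2] iH[of "Suc j"] by (subst Bochner_Integration.integral_add) auto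
        finally show ?thesis .
      qed
      define G_inf where "G_inf = (\<Inter>j. G j)"
      have [measurable]: "G_inf \<in> sets M" unfolding G_inf_def by measurable
      have "prob G_inf = 0"
      proof (rule ccontr)
        assume "prob G_inf \<noteq> 0"
        then have pos: "prob G_inf > 0" by (simp add: zero_less_measure_iff)
        have "q n0 + (\<Sum>j<i. w (n + n0 + j)) * prob G_inf \<le> q (n0 + i)" for i
        proof (induction i)
          case (Suc i)
          have "prob G_inf \<le> prob (G (n0 + i))"
            by (intro finite_measure_mono) (auto simp: G_inf_def)
          then have "w (n + n0 + i) * prob G_inf \<le> w (n + (n0 + i)) * prob (G (n0 + i))"
            using w(1) by (simp add: add.assoc mult_left_mono)
          then show ?case using Suc q_Suc[of "n0 + i"] by (simp add: algebra_simps)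
        qed auto
        moreover have "0 \<le> q n0" unfolding q_def by simp
        ultimately have "(\<Sum>j<i. w (n + n0 + j)) * prob G_inf \<le> (K + 1)\<^sup>2" for i
          using q_le[of "n0 + i"] by (smt (verit))
        then have "(\<Sum>j<i. w (n + n0 + j)) \<le> (K + 1)\<^sup>2 / prob G_inf" for i
          using pos by (simp add: le_divide_eq)
        then have "summable (\<lambda>j. w (n + n0 + j))"
          using w(1) by (intro summableI_nonneg_bounded) auto
        then show False using w(2) summable_iff_shift[of w "n + n0"] by (simp add: add.commute)
      qed
      moreover have "K * prob (\<Union>j. H j) \<le> expectation (\<lambda>\<omega>. \<bar>Y n \<omega>\<bar>)"
      proof (rule LIMSEQ_le_const2)
        have "H j \<subseteq> H (Suc j)" for j by (auto simp: H_Suc)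
        then show "(\<lambda>j. K * prob (H j)) \<longlonglongrightarrow> K * prob (\<Union>j. H j)"
          by (intro tendsto_intros finite_Lim_measure_incseq) (auto intro!: incseq_SucI)
        have nonneg: "0 \<le> expectation (\<lambda>\<omega>. indicator (G j) \<omega> * Y (n + j) \<omega>)" for j
        proof (intro Bochner_Integration.integral_nonneg)
          show "0 \<le> indicator (G j) \<omega> * Y (n + j) \<omega>" for \<omega>
            by (cases "\<omega> \<in> G j") (simp_all add: G_def less_imp_le)
        qed
        have "K * prob (H j) \<le> expectation (\<lambda>\<omega>. \<bar>Y n \<omega>\<bar>)" for j
          using linear[of j] nonneg[of j] by linarith
        then show "\<exists>N. \<forall>j\<ge>N. K * prob (H j) \<le> expectation (\<lambda>\<omega>. \<bar>Y n \<omega>\<bar>)" by blast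
      qed
      moreover have "prob A \<le> prob (G_inf \<union> (\<Union>j. H j))"
      proof (intro finite_measure_mono subsetI)
        fix \<omega> assume "\<omega> \<in> A"
        then have pos: "\<omega> \<in> space M" "\<And>i. 0 < Y (n + i) \<omega>" by (auto simp: A_def)
        have "\<omega> \<in> G j" if "\<omega> \<notin> (\<Union>j. H j)" for j
        proof (induction j)
          case 0
          then show ?case using that pos pos(2)[of 0] by (force simp: G_def H_def not_le[symmetric])
        next
          case (Suc j)
          then show ?case using that pos(2)[of "Suc j"] H_Suc[of \<omega> j] by (auto simp: G_Suc not_le)
        qed
        then show "\<omega> \<in> G_inf \<union> (\<Union>j. H j)" by (auto simp: G_inf_def)
      qed measurable
      moreover have "prob (G_inf \<union> (\<Union>j. H j)) \<le> prob G_inf + prob (\<Union>j. H j)"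
        by (intro measure_Un_le) measurable
      ultimately have "prob A \<le> prob (\<Union>j. H j)" by linarith
      then show ?thesis
        using \<open>K * prob (\<Union>j. H j) \<le> _\<close> mult_left_mono[of "prob A" "prob (\<Union>j. H j)" K] that by linarith
    qed
    note le = this
    have "prob A = 0"
    proof (rule ccontr)
      assume "prob A \<noteq> 0"
      then have pos: "prob A > 0" by (simp add: zero_less_measure_iff)
      define E where "E = expectation (\<lambda>\<omega>. \<bar>Y n \<omega>\<bar>)"
      have "0 \<le> E" by (simp add: E_def)
      then have "(E + 1) / prob A * prob A \<le> E" unfolding E_def[symmetric] using pos
        by (intro le[folded E_def]) auto
      then show False using pos by simp
    qed
    then have "AE \<omega> in M. \<omega> \<notin> A" by (intro AE_not_in) (auto simp: null_sets_def emeasure_eq_measure)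
    then show ?thesis using AE_space by eventually_elim (simp add: A_def)
  qed
  then have "AE \<omega> in M. \<forall>n. \<not> (\<forall>k\<ge>n. 0 < Y k \<omega>)" by (subst AE_all_countable) blast
  then show ?thesis by eventually_elim (simp add: eventually_sequentially)
qed

section \<open>The law of the next step\<close>

lemma space_history [simp]: "space (history M \<sigma> N m n) = space M"
  by (simp add: history_def space_measure_of_conv)

lemma sets_history:
  "sets (history M \<sigma> N m n) = sigma_sets (space M)
     ({\<sigma> k -` A \<inter> space M | k A. k \<in> {1..m} \<and> A \<in> sets borel} \<union>
      {N k -` A \<inter> space M | k A. k \<in> {1..n}})"
  unfolding history_def by (rule sets_measure_of) auto

lemma sets_history_mono:
  assumes "m \<le> m'" "n \<le> n'"
  shows "sets (history M \<sigma> N m n) \<subseteq> sets (history M \<sigma> N m' n')"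
proof -
  have "{1..m} \<subseteq> {1..m'}" "{1..n} \<subseteq> {1..n'}" using assms by auto
  then show ?thesis unfolding sets_history by (intro sigma_sets_subseteq Un_mono) blast+
qed

lemma step_measurable_history:
  "k \<in> {1..m} \<Longrightarrow> \<sigma> k \<in> borel_measurable (history M \<sigma> N m n)"
  unfolding measurable_def sets_history space_history by (auto intro!: sigma_sets.Basic)

lemma finite_unit_steps [simp]: "finite (unit_steps :: (real ^ 'd :: finite) set)"
  by (simp add: unit_steps_def)

lemma sum_unit_steps:
  fixes g :: "real ^ 'd :: finite \<Rightarrow> real"
  shows "sum g unit_steps = (\<Sum>i\<in>UNIV. g (axis i 1) + g (- axis i 1))"
proof -
  have neq: "axis i 1 \<noteq> - axis j (1 :: real)" for i j :: 'd
  proof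
    assume "axis i 1 = - axis j (1 :: real)"
    then have "axis i (1 :: real) $ i = (- axis j 1) $ i" by simp
    then show False by (simp add: axis_def split: if_splits)
  qed
  have inj: "inj (\<lambda>i :: 'd. axis i (1 :: real))" by (auto simp: inj_on_def axis_eq_axis)
  have "sum g unit_steps = sum g (range (\<lambda>i. axis i 1)) + sum g (range (\<lambda>i. - axis i 1))"
    unfolding unit_steps_def using neq by (intro sum.union_disjoint) auto
  also have "\<dots> = (\<Sum>i\<in>UNIV. g (axis i 1)) + (\<Sum>i\<in>UNIV. g (- axis i 1))"
    using inj by (simp add: sum.reindex inj_on_def)
  finally show ?thesis by (simp add: sum.distrib)
qed

lemma sum_unit_steps_inner:
  fixes u :: "real ^ 'd :: finite"
  shows "(\<Sum>v\<in>unit_steps. v \<bullet> u) = 0"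
  by (simp add: sum_unit_steps)

lemma inner_unit_steps:
  fixes u v :: "real ^ 'd :: finite"
  assumes "u \<in> unit_steps" "v \<in> unit_steps"
  shows "v \<bullet> u \<in> {-1, 0, 1}"
  using assms by (auto simp: unit_steps_def inner_axis_axis)

lemma sum_unit_steps_inner_square:
  fixes u :: "real ^ 'd :: finite"
  assumes "u \<in> unit_steps"
  shows "(\<Sum>v\<in>unit_steps. (v \<bullet> u)\<^sup>2) = 2"
proof -
  obtain j where j: "u = axis j 1 \<or> u = - axis j 1" using assms by (auto simp: unit_steps_def)
  then have "(axis i 1 \<bullet> u)\<^sup>2 = (if i = j then 1 else 0)" for i :: 'd
    by (auto simp: inner_axis_axis)
  then show ?thesis by (simp add: sum_unit_steps sum_distrib_left[symmetric])
qed

context elephant_random_walk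
begin

text \<open>
The time is shifted by one: \<open>past n\<close> knows the first \<open>n + 1\<close> steps, but none of the draw that
produces step \<open>n + 2\<close>. In this way every time index \<open>n \<ge> 0\<close> has a next step that obeys the
transition rule.
\<close>

definition past :: "nat \<Rightarrow> 'w measure" where "past n = history M \<sigma> N (Suc n) n"

definition q :: real where "q = (1 - p) / (2 * real CARD('d) - 1)"

definition a :: real where "a = p - q"

lemma subalgebra_history: "subalgebra M (history M \<sigma> N m n)"
proof -
  have "sigma_sets (space M) ({\<sigma> k -` A \<inter> space M | k A. k \<in> {1..m} \<and> A \<in> sets borel} \<union>
      {N k -` A \<inter> space M | k A. k \<in> {1..n}}) \<subseteq> sets M"
    using measurable_sets[OF step_measurable] measurable_sets[OF N_measurable]
    by (intro sets.sigma_sets_subset) fastforce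
  then show ?thesis unfolding subalgebra_def sets_history by simp
qed

sublocale filtered_prob_space M past
proof
  show "subalgebra M (past n)" for n by (simp add: past_def subalgebra_history)
  show "m \<le> n \<Longrightarrow> sets (past m) \<subseteq> sets (past n)" for m n
    unfolding past_def by (intro sets_history_mono) auto
qed

lemma denominator_pos: "0 < 2 * real CARD('d) - 1"
proof -
  have "1 \<le> real CARD('d)" by (simp add: Suc_leI)
  then show ?thesis by linarith
qed

lemma q_nonneg: "0 \<le> q"
  unfolding q_def using p_range denominator_pos by (intro divide_nonneg_pos) auto

lemma total_mass: "2 * real CARD('d) * q + a = 1"
proof -
  have "(2 * real CARD('d) - 1) * q = 1 - p"
  proof -
    have "2 * real CARD('d) - 1 \<noteq> 0" using denominator_pos by linarith
    then show ?thesis unfolding q_def times_divide_eq_right by (rule nonzero_mult_div_cancel_left)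
  qed
  then show ?thesis by (simp add: a_def algebra_simps)
qed

lemma step_measurable_M [measurable]: "\<sigma> (Suc n) \<in> borel_measurable M"
  by (simp add: step_measurable)

lemma step_measurable_past: "k \<in> {1..Suc n} \<Longrightarrow> \<sigma> k \<in> borel_measurable (past n)"
  unfolding past_def by (rule step_measurable_history)

text \<open>
The memory draw is independent of the past that precedes it, so a weight known before the draw
can be averaged separately.
\<close>

lemma draw_independent:
  assumes g: "bounded_at n g"
  shows "expectation (\<lambda>\<omega>. g \<omega> * indicator {\<omega>. N (Suc n) \<omega> = k} \<omega>)
    = expectation g * (if k \<in> {1..Suc n} then 1 / real (Suc n) else 0)"
proof -
  let ?B = "\<lambda>\<omega>. indicator {\<omega>. N (Suc n) \<omega> = k} \<omega> :: real"
  have [measurable]: "N (Suc n) \<in> measurable M (count_space UNIV)" by (rule N_measurable) simp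
  have B_eq: "?B = (\<lambda>\<omega>. indicator {k} (N (Suc n) \<omega>))" by (auto simp: indicator_def)
  have [measurable]: "?B \<in> borel_measurable M"
    unfolding B_eq by (rule measurable_compose[OF N_measurable]) auto
  have iB: "integrable M ?B"
    by (rule integrable_const_bound[where B = 1]) auto
  have "indep_var borel g borel ?B"
    unfolding indep_var_eq
  proof (intro conjI)
    show "random_variable borel g" using g by (rule bounded_at_measurable_M)
    show "random_variable borel ?B" by measurable
    have "{g -` A \<inter> space M | A. A \<in> sets borel} \<subseteq> sets (history M \<sigma> N (Suc n) n)"
      using measurable_sets[OF bounded_at_measurable[OF g]] by (auto simp: past_def)
    then have 1: "sigma_sets (space M) {g -` A \<inter> space M | A. A \<in> sets borel} \<subseteq> sets (history M \<sigma> N (Suc n) n)"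
      using sets.sigma_sets_subset[of _ "history M \<sigma> N (Suc n) n"] by simp
    have "{?B -` A \<inter> space M | A. A \<in> sets borel}
        \<subseteq> {N (Suc n) -` A \<inter> space M | A. A \<in> sets (count_space UNIV)}"
    proof safe
      fix A :: "real set"
      show "\<exists>A'. ?B -` A \<inter> space M = N (Suc n) -` A' \<inter> space M \<and> A' \<in> sets (count_space UNIV)"
        by (intro exI[of _ "indicator {k} -` A"]) (auto simp: B_eq)
    qed
    then have 2: "sigma_sets (space M) {?B -` A \<inter> space M | A. A \<in> sets borel}
        \<subseteq> sets (vimage_algebra (space M) (N (Suc n)) (count_space UNIV))"
      unfolding sets_vimage_algebra by (rule sigma_sets_subseteq)
    show "indep_set (sigma_sets (space M) {g -` A \<inter> space M | A. A \<in> sets borel})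
        (sigma_sets (space M) {?B -` A \<inter> space M | A. A \<in> sets borel})"
      unfolding indep_set_def
    proof (rule indep_sets_mono_sets)
      show "indep_sets (case_bool (sets (history M \<sigma> N (Suc n) n))
          (sets (vimage_algebra (space M) (N (Suc n)) (count_space UNIV)))) UNIV"
        using N_indep_past[of "Suc n"] by (simp add: indep_set_def)
    qed (use 1 2 in \<open>simp split: bool.split\<close>)
  qed
  then have "expectation (\<lambda>\<omega>. g \<omega> * ?B \<omega>) = expectation g * expectation ?B"
    using bounded_at_integrable[OF g] iB by (rule indep_var_lebesgue_integral)
  also have "expectation ?B = prob {\<omega> \<in> space M. N (Suc n) \<omega> = k}"
  proof -
    have "expectation ?B = expectation (indicator {\<omega> \<in> space M. N (Suc n) \<omega> = k})"
      by (intro Bochner_Integration.integral_cong) (auto simp: indicator_def)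
    then show ?thesis by simp
  qed
  also have "\<dots> = measure (distr M (count_space UNIV) (N (Suc n))) {k}"
    by (subst measure_distr) (auto intro!: arg_cong[of _ _ prob])
  also have "\<dots> = (if k \<in> {1..Suc n} then 1 / real (Suc n) else 0)"
    by (subst N_uniform) (auto simp: measure_pmf_single indicator_def)
  finally show ?thesis .
qed

lemma AE_draw_range: "AE \<omega> in M. N (Suc n) \<omega> \<in> {1..Suc n}"
proof -
  have "AE k in distr M (count_space UNIV) (N (Suc n)). k \<in> {1..Suc n}"
    by (subst N_uniform) (auto simp: AE_measure_pmf_iff)
  then show ?thesis using N_measurable[of "Suc n"] by (subst (asm) AE_distr_iff) auto
qed

definition visits :: "nat \<Rightarrow> real ^ 'd \<Rightarrow> 'w \<Rightarrow> real" where
  "visits m v \<omega> = (\<Sum>k=1..m. indicator {v} (\<sigma> k \<omega>))"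

lemma bounded_at_step_function:
  assumes "k \<in> {1..Suc n}" "h \<in> borel_measurable borel" "\<And>v. \<bar>h v\<bar> \<le> C"
  shows "bounded_at n (\<lambda>\<omega>. h (\<sigma> k \<omega>))"
  by (rule bounded_atI[where C = C])
     (use measurable_compose[OF step_measurable_past[OF assms(1)] assms(2)] assms(3) in auto)

text \<open>
The conditional law of the next step given the past. The transition rule also conditions on
the draw; splitting according to its value \<open>k\<close> and averaging over the \<open>n + 1\<close> equally likely
values turns the recalled step into the proportion of earlier visits to \<open>v\<close>.
\<close>

lemma transition_expectation:
  assumes f: "bounded_at n f" and v: "v \<in> unit_steps"
  shows "expectation (\<lambda>\<omega>. f \<omega> * indicator {v} (\<sigma> (Suc (Suc n)) \<omega>)) =
    expectation (\<lambda>\<omega>. f \<omega> * (q + a / real (Suc n) * visits (Suc n) v \<omega>))"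
proof -
  let ?m = "Suc n"
  let ?H = "history M \<sigma> N ?m ?m"
  let ?I = "indicator {\<omega>' \<in> space M. \<sigma> (Suc ?m) \<omega>' = v} :: 'w \<Rightarrow> real"
  interpret H: finite_measure_subalgebra M ?H
    by unfold_locales (rule subalgebra_history)
  have fM [measurable]: "f \<in> borel_measurable M" using f by (rule bounded_at_measurable_M)
  have fH: "f \<in> borel_measurable ?H"
  proof (rule measurable_from_subalg)
    show "subalgebra ?H (past n)"
      unfolding subalgebra_def past_def using sets_history_mono[of ?m ?m n ?m] by simp
  qed (use f in \<open>rule bounded_at_measurable\<close>)
  have I: "?I \<in> borel_measurable M" by measurable
  have fI: "integrable M (\<lambda>\<omega>. f \<omega> * ?I \<omega>)"
    using integrable_mult_indicator[OF _ bounded_at_integrable[OF f], of "{\<omega>' \<in> space M. \<sigma> (Suc ?m) \<omega>' = v}"]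
    by (simp add: mult.commute)
  let ?J = "\<lambda>k \<omega>. (f \<omega> * indicator {v} (\<sigma> k \<omega>)) * indicator {\<omega>. N ?m \<omega> = k} \<omega>"
  have g: "bounded_at n (\<lambda>\<omega>. f \<omega> * indicator {v} (\<sigma> k \<omega>))" if "k \<in> {1..?m}" for k
    using f bounded_at_step_function[OF that, of "indicator {v}" 1] by auto
  have iJ: "integrable M (?J k)" if "k \<in> {1..?m}" for k
  proof -
    have [measurable]: "N ?m \<in> measurable M (count_space UNIV)" by (rule N_measurable) simp
    have "integrable M (\<lambda>\<omega>. (f \<omega> * indicator {v} (\<sigma> k \<omega>)) * indicator {\<omega> \<in> space M. N ?m \<omega> = k} \<omega>)"
      using integrable_mult_indicator[OF _ bounded_at_integrable[OF g[OF that]], of "{\<omega> \<in> space M. N ?m \<omega> = k}"]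
      by (simp add: mult.commute)
    then show ?thesis
      by (rule Bochner_Integration.integrable_cong[THEN iffD1, rotated -1]) (auto simp: indicator_def)
  qed
  have "expectation (\<lambda>\<omega>. f \<omega> * indicator {v} (\<sigma> (Suc ?m) \<omega>)) = expectation (\<lambda>\<omega>. f \<omega> * ?I \<omega>)"
    by (intro Bochner_Integration.integral_cong) (auto simp: indicator_def)
  also have "\<dots> = expectation (\<lambda>\<omega>. f \<omega> * real_cond_exp M ?H ?I \<omega>)"
    by (rule H.real_cond_exp_intg(2)[symmetric]) (use fI fH I in auto)
  also have "\<dots> = expectation (\<lambda>\<omega>. q * f \<omega> + a * (\<Sum>k=1..?m. ?J k \<omega>))"
  proof (intro integral_cong_AE)
    have [measurable]: "(\<lambda>\<omega>. \<Sum>k=1..?m. ?J k \<omega>) \<in> borel_measurable M"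
      using iJ by (intro borel_measurable_sum) auto
    show "(\<lambda>\<omega>. q * f \<omega> + a * (\<Sum>k=1..?m. ?J k \<omega>)) \<in> borel_measurable M" by measurable
    show "(\<lambda>\<omega>. f \<omega> * real_cond_exp M ?H ?I \<omega>) \<in> borel_measurable M" by measurable
    show "AE \<omega> in M. f \<omega> * real_cond_exp M ?H ?I \<omega> = q * f \<omega> + a * (\<Sum>k=1..?m. ?J k \<omega>)"
      using transition[OF le_add1[of 1 n, unfolded plus_1_eq_Suc] v] AE_draw_range[of n]
    proof eventually_elim
      case (elim \<omega>)
      have W: "real_cond_exp M ?H ?I \<omega> = q + a * indicator {v} (\<sigma> (N ?m \<omega>) \<omega>)"
        using elim(1) unfolding q_def[symmetric] a_def by (auto simp: indicator_def)
      have "(\<Sum>k=1..?m. ?J k \<omega>) = (\<Sum>k=1..?m. if k = N ?m \<omega> then f \<omega> * indicator {v} (\<sigma> k \<omega>) else 0)"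
        by (intro sum.cong) (auto simp: indicator_def)
      also have "\<dots> = f \<omega> * indicator {v} (\<sigma> (N ?m \<omega>) \<omega>)"
        using elim(2) by (subst sum.delta) auto
      finally show ?case unfolding W by (simp only: distrib_left mult_ac)
    qed
  qed
  also have "\<dots> = q * expectation f + a * (\<Sum>k=1..?m. expectation (?J k))"
  proof -
    have "integrable M (\<lambda>\<omega>. \<Sum>k=1..?m. ?J k \<omega>)"
      by (intro Bochner_Integration.integrable_sum iJ)
    moreover have "expectation (\<lambda>\<omega>. \<Sum>k=1..?m. ?J k \<omega>) = (\<Sum>k=1..?m. expectation (?J k))"
      by (intro Bochner_Integration.integral_sum iJ)
    ultimately show ?thesis
      using bounded_at_integrable[OF f]
      by (simp only: Bochner_Integration.integral_add integrable_mult_right integral_mult_right_zero)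
  qed
  also have "(\<Sum>k=1..?m. expectation (?J k)) = (\<Sum>k=1..?m. expectation (\<lambda>\<omega>. f \<omega> * indicator {v} (\<sigma> k \<omega>))) / real ?m"
    unfolding sum_divide_distrib using draw_independent[OF g] by (intro sum.cong) auto
  also have "(\<Sum>k=1..?m. expectation (\<lambda>\<omega>. f \<omega> * indicator {v} (\<sigma> k \<omega>))) = expectation (\<lambda>\<omega>. f \<omega> * visits ?m v \<omega>)"
    unfolding visits_def sum_distrib_left
    using g by (intro Bochner_Integration.integral_sum[symmetric] bounded_at_integrable[of n]) auto
  also have "q * expectation f + a * (expectation (\<lambda>\<omega>. f \<omega> * visits ?m v \<omega>) / real ?m)
    = expectation (\<lambda>\<omega>. q * f \<omega> + a / real ?m * (f \<omega> * visits ?m v \<omega>))"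
  proof -
    have "bounded_at n (\<lambda>\<omega>. f \<omega> * visits ?m v \<omega>)"
      unfolding visits_def sum_distrib_left
      by (rule bounded_at_sum) (use g in auto)
    then show ?thesis
      using bounded_at_integrable f by (subst Bochner_Integration.integral_add) auto
  qed
  finally show ?thesis by (simp add: algebra_simps)
qed

lemma sum_visits:
  assumes "\<forall>k\<in>{1..m}. \<sigma> k \<omega> \<in> unit_steps"
  shows "(\<Sum>v\<in>unit_steps. g v * visits m v \<omega>) = (\<Sum>k=1..m. g (\<sigma> k \<omega>))"
proof -
  have "(\<Sum>v\<in>unit_steps. g v * visits m v \<omega>) = (\<Sum>k=1..m. \<Sum>v\<in>unit_steps. g v * indicator {v} (\<sigma> k \<omega>))"
    unfolding visits_def sum_distrib_left by (rule sum.swap)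
  also have "\<dots> = (\<Sum>k=1..m. g (\<sigma> k \<omega>))"
  proof (rule sum.cong[OF refl])
    fix k assume k: "k \<in> {1..m}"
    have "(\<Sum>v\<in>unit_steps. g v * indicator {v} (\<sigma> k \<omega>)) = (\<Sum>v\<in>unit_steps. if v = \<sigma> k \<omega> then g v else 0)"
      by (intro sum.cong) auto
    then show "(\<Sum>v\<in>unit_steps. g v * indicator {v} (\<sigma> k \<omega>)) = g (\<sigma> k \<omega>)"
      using assms k by simp
  qed
  finally show ?thesis .
qed

lemma bounded_at_visits: "bounded_at n (visits (Suc n) v)"
  unfolding visits_def[abs_def]
  by (rule bounded_at_sum, rule bounded_at_step_function[where C = 1]) auto

text \<open>
That the steps lie in \<open>unit_steps\<close> follows by induction: if the first \<open>m\<close> steps do, then the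
numbers of visits to the elements of \<open>unit_steps\<close> add up to \<open>m\<close>.
\<close>

lemma AE_unit_steps_upto: "AE \<omega> in M. \<forall>k\<in>{1..m}. \<sigma> k \<omega> \<in> unit_steps"
proof (induction m)
  case (Suc m)
  show ?case
  proof (cases m)
    case 0
    have "axis i1 1 \<in> unit_steps" by (simp add: unit_steps_def)
    then have "\<sigma> (Suc 0) \<omega> \<in> unit_steps" if "\<omega> \<in> space M" for \<omega> using step_1[OF that] by simp
    then show ?thesis using AE_space 0 by auto
  next
    case (Suc n)
    let ?V = "unit_steps :: (real ^ 'd) set"
    let ?E = "{\<omega> \<in> space M. \<sigma> (Suc (Suc n)) \<omega> \<in> unit_steps}"
    have E [measurable]: "?E \<in> sets M"
    proof -
      have "?V \<in> sets borel" using finite_imp_closed[OF finite_unit_steps] by (rule borel_closed)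
      then have "\<sigma> (Suc (Suc n)) -` ?V \<inter> space M \<in> sets M" by (rule measurable_sets[OF step_measurable_M])
      also have "\<sigma> (Suc (Suc n)) -` ?V \<inter> space M = ?E" by auto
      finally show ?thesis .
    qed
    \<comment> \<open>the masses given to the unit steps by the transition rule add up to \<open>1\<close>\<close>
    have "prob ?E = expectation (\<lambda>\<omega>. \<Sum>v\<in>unit_steps. indicator {v} (\<sigma> (Suc (Suc n)) \<omega>))"
    proof -
      have "prob ?E = expectation (indicator ?E)" by simp
      also have "\<dots> = expectation (\<lambda>\<omega>. \<Sum>v\<in>unit_steps. indicator {v} (\<sigma> (Suc (Suc n)) \<omega>))"
        by (intro Bochner_Integration.integral_cong) (auto simp: indicator_def)
      finally show ?thesis .
    qed
    also have "\<dots> = (\<Sum>v\<in>unit_steps. expectation (\<lambda>\<omega>. indicator {v} (\<sigma> (Suc (Suc n)) \<omega>)))"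
    proof (rule Bochner_Integration.integral_sum)
      show "integrable M (\<lambda>\<omega>. indicator {v} (\<sigma> (Suc (Suc n)) \<omega>) :: real)" for v
        using bounded_at_integrable[OF bounded_at_step_function[of "Suc (Suc n)" "Suc n" "indicator {v}" 1]]
        by (auto simp: indicator_def)
    qed
    also have "\<dots> = (\<Sum>v\<in>?V. expectation (\<lambda>\<omega>. q + a / real (Suc n) * visits (Suc n) v \<omega>))"
      using transition_expectation[OF bounded_at_const[of n 1]] by (intro sum.cong) auto
    also have "\<dots> = expectation (\<lambda>\<omega>. \<Sum>v\<in>?V. q + a / real (Suc n) * visits (Suc n) v \<omega>)"
      using bounded_at_visits[of n]
      by (intro Bochner_Integration.integral_sum[symmetric] bounded_at_integrable[of n]) auto
    also have "\<dots> = expectation (\<lambda>\<omega>. 1)"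
    proof (rule integral_cong_AE)
      show "AE \<omega> in M. (\<Sum>v\<in>?V. q + a / real (Suc n) * visits (Suc n) v \<omega>) = 1"
        using Suc.IH
      proof eventually_elim
        case (elim \<omega>)
        have "(\<Sum>v\<in>?V. q + a / real (Suc n) * visits (Suc n) v \<omega>)
          = (\<Sum>v\<in>?V. q) + a / real (Suc n) * (\<Sum>v\<in>?V. 1 * visits (Suc n) v \<omega>)"
          unfolding sum.distrib sum_distrib_left by simp
        also have "(\<Sum>v\<in>?V. 1 * visits (Suc n) v \<omega>) = (\<Sum>k=1..Suc n. 1)"
          using elim unfolding \<open>m = Suc n\<close> by (rule sum_visits)
        also have "(\<Sum>v\<in>?V. q) = 2 * real CARD('d) * q"
          unfolding sum_unit_steps by simp
        finally show ?case using total_mass by simp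
      qed
    qed (use bounded_at_visits[of n, THEN bounded_at_measurable_M] in measurable)
    finally have "prob ?E = 1" by (simp add: prob_space)
    then have "AE \<omega> in M. \<sigma> (Suc (Suc n)) \<omega> \<in> unit_steps"
      using prob_eq_1[OF E] by (auto elim: eventually_mono)
    with Suc.IH show ?thesis unfolding \<open>m = Suc n\<close>
      by eventually_elim (auto simp: le_Suc_eq)
  qed
qed auto

lemma step_expectation:
  assumes f: "bounded_at n f" and g [measurable]: "g \<in> borel_measurable borel"
  shows "expectation (\<lambda>\<omega>. f \<omega> * g (\<sigma> (Suc (Suc n)) \<omega>)) =
    expectation (\<lambda>\<omega>. f \<omega> * (q * (\<Sum>v\<in>unit_steps. g v) + a / real (Suc n) * (\<Sum>k=1..Suc n. g (\<sigma> k \<omega>))))"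
proof -
  let ?V = "unit_steps :: (real ^ 'd) set"
  have b: "bounded_at (Suc n) (\<lambda>\<omega>. f \<omega> * indicator {v} (\<sigma> (Suc (Suc n)) \<omega>))" for v
    using bounded_at_mono[OF _ f, of "Suc n"]
      bounded_at_step_function[of "Suc (Suc n)" "Suc n" "indicator {v}" 1] by auto
  have b': "bounded_at n (\<lambda>\<omega>. f \<omega> * (q + a / real (Suc n) * visits (Suc n) v \<omega>))" for v
    using f bounded_at_visits[of n v] by auto
  note u = AE_unit_steps_upto[of "Suc (Suc n)"]
  have eq1: "AE \<omega> in M. f \<omega> * g (\<sigma> (Suc (Suc n)) \<omega>) = (\<Sum>v\<in>?V. g v * (f \<omega> * indicator {v} (\<sigma> (Suc (Suc n)) \<omega>)))"
    using u
  proof eventually_elim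
    case (elim \<omega>)
    have "(\<Sum>v\<in>?V. g v * (f \<omega> * indicator {v} (\<sigma> (Suc (Suc n)) \<omega>)))
      = (\<Sum>v\<in>?V. if v = \<sigma> (Suc (Suc n)) \<omega> then f \<omega> * g v else 0)"
      by (intro sum.cong) auto
    then show ?case using elim by simp
  qed
  have eq2: "AE \<omega> in M. (\<Sum>v\<in>?V. g v * (f \<omega> * (q + a / real (Suc n) * visits (Suc n) v \<omega>)))
    = f \<omega> * (q * (\<Sum>v\<in>unit_steps. g v) + a / real (Suc n) * (\<Sum>k=1..Suc n. g (\<sigma> k \<omega>)))"
    using u
  proof eventually_elim
    case (elim \<omega>)
    have "(\<Sum>v\<in>?V. g v * visits (Suc n) v \<omega>) = (\<Sum>k=1..Suc n. g (\<sigma> k \<omega>))"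
      by (rule sum_visits) (use elim in auto)
    moreover have "(\<Sum>v\<in>?V. g v * (f \<omega> * (q + r * visits (Suc n) v \<omega>)))
      = f \<omega> * (q * (\<Sum>v\<in>?V. g v) + r * (\<Sum>v\<in>?V. g v * visits (Suc n) v \<omega>))" for r
      unfolding sum_distrib_left sum.distrib[symmetric] by (simp add: algebra_simps)
    ultimately show ?case by (simp only:)
  qed
  note [measurable] = bounded_at_measurable_M[OF f] bounded_at_measurable_M[OF bounded_at_visits]
  have steps [measurable]: "\<sigma> k \<in> borel_measurable M" if "k \<in> {1..Suc n}" for k
    using that by (simp add: step_measurable)
  have "expectation (\<lambda>\<omega>. f \<omega> * g (\<sigma> (Suc (Suc n)) \<omega>))
    = expectation (\<lambda>\<omega>. \<Sum>v\<in>?V. g v * (f \<omega> * indicator {v} (\<sigma> (Suc (Suc n)) \<omega>)))"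
    by (rule integral_cong_AE) (use eq1 in auto)
  also have "\<dots> = (\<Sum>v\<in>?V. g v * expectation (\<lambda>\<omega>. f \<omega> * indicator {v} (\<sigma> (Suc (Suc n)) \<omega>)))"
    using bounded_at_integrable[OF b] by (subst Bochner_Integration.integral_sum) auto
  also have "\<dots> = (\<Sum>v\<in>?V. g v * expectation (\<lambda>\<omega>. f \<omega> * (q + a / real (Suc n) * visits (Suc n) v \<omega>)))"
    by (intro sum.cong refl arg_cong2[where f = "(*)"] transition_expectation f)
  also have "\<dots> = expectation (\<lambda>\<omega>. \<Sum>v\<in>?V. g v * (f \<omega> * (q + a / real (Suc n) * visits (Suc n) v \<omega>)))"
    using bounded_at_integrable[OF b'] by (subst Bochner_Integration.integral_sum) auto
  also have "\<dots> = expectation (\<lambda>\<omega>. f \<omega> * (q * (\<Sum>v\<in>unit_steps. g v) + a / real (Suc n) * (\<Sum>k=1..Suc n. g (\<sigma> k \<omega>))))"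
  proof (rule integral_cong_AE[OF _ _ eq2])
    have "(\<lambda>\<omega>. \<Sum>k=1..Suc n. g (\<sigma> k \<omega>)) \<in> borel_measurable M"
      using measurable_compose[OF steps g] by (intro borel_measurable_sum)
    then show "(\<lambda>\<omega>. f \<omega> * (q * (\<Sum>v\<in>unit_steps. g v) + a / real (Suc n) * (\<Sum>k=1..Suc n. g (\<sigma> k \<omega>))))
      \<in> borel_measurable M" by measurable
  qed measurable
  finally show ?thesis .
qed

section \<open>Moments of one coordinate\<close>

text \<open>
As the steps are unit vectors along the axes, this counts the steps taken along the axis of \<open>u\<close>.
It governs the conditional variance of the next step.
\<close>

definition energy :: "real ^ 'd \<Rightarrow> nat \<Rightarrow> 'w \<Rightarrow> real" where
  "energy u m \<omega> = (\<Sum>k=1..m. (\<sigma> k \<omega> \<bullet> u)\<^sup>2)"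

lemma S_inner: "\<omega> \<in> space M \<Longrightarrow> S m \<omega> \<bullet> u = (\<Sum>k=1..m. \<sigma> k \<omega> \<bullet> u)"
  by (induction m) (auto simp: S_0 S_Suc inner_add_left)

lemma AE_inner_unit_steps:
  assumes "u \<in> unit_steps"
  shows "AE \<omega> in M. \<forall>k\<in>{1..m}. \<sigma> k \<omega> \<bullet> u \<in> {-1, 0, 1}"
  using AE_unit_steps_upto[of m] by eventually_elim (use inner_unit_steps[OF assms] in blast)

lemma AE_abs_S_inner_le:
  assumes "u \<in> unit_steps"
  shows "AE \<omega> in M. \<bar>S m \<omega> \<bullet> u\<bar> \<le> real m"
  using AE_inner_unit_steps[OF assms, of m] AE_space
proof eventually_elim
  case (elim \<omega>)
  have "\<bar>\<Sum>k=1..m. \<sigma> k \<omega> \<bullet> u\<bar> \<le> (\<Sum>k=1..m. \<bar>\<sigma> k \<omega> \<bullet> u\<bar>)" by (rule sum_abs)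
  also have "\<dots> \<le> (\<Sum>k=1..m. 1)" by (intro sum_mono) (use elim in force)
  finally show ?case using elim by (simp add: S_inner)
qed

lemma AE_energy_bounds:
  assumes "u \<in> unit_steps"
  shows "AE \<omega> in M. (S m \<omega> \<bullet> u)\<^sup>2 \<le> real m * energy u m \<omega> \<and> 0 \<le> energy u m \<omega> \<and> energy u m \<omega> \<le> real m"
  using AE_inner_unit_steps[OF assms, of m] AE_space
proof eventually_elim
  case (elim \<omega>)
  have "energy u m \<omega> \<le> (\<Sum>k=1..m. 1)" unfolding energy_def by (intro sum_mono) (use elim in force)
  moreover have "(\<Sum>k=1..m. \<sigma> k \<omega> \<bullet> u)\<^sup>2 \<le> energy u m \<omega> * real (card {1..m})"
    unfolding energy_def by (rule sum_squared_le_sum_of_squares)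
  ultimately show ?case using elim by (simp add: S_inner mult.commute energy_def sum_nonneg)
qed

lemma bounded_at_S_inner:
  assumes "u \<in> unit_steps"
  shows "bounded_at n (\<lambda>\<omega>. S (Suc n) \<omega> \<bullet> u)"
proof (rule bounded_atI[OF _ AE_abs_S_inner_le[OF assms]])
  have "(\<lambda>\<omega>. \<Sum>k=1..Suc n. \<sigma> k \<omega> \<bullet> u) \<in> borel_measurable (past n)"
    using step_measurable_past by (intro borel_measurable_sum borel_measurable_inner) auto
  then show "(\<lambda>\<omega>. S (Suc n) \<omega> \<bullet> u) \<in> borel_measurable (past n)"
    by (rule measurable_cong[THEN iffD1, rotated]) (simp add: S_inner)
qed

lemma bounded_at_energy:
  assumes "u \<in> unit_steps"
  shows "bounded_at n (energy u (Suc n))"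
proof (rule bounded_atI)
  show "energy u (Suc n) \<in> borel_measurable (past n)"
    unfolding energy_def[abs_def] using step_measurable_past
    by (intro borel_measurable_sum borel_measurable_power borel_measurable_inner) auto
  show "AE \<omega> in M. \<bar>energy u (Suc n) \<omega>\<bar> \<le> real (Suc n)"
    using AE_energy_bounds[OF assms, of "Suc n"] by eventually_elim auto
qed

lemma S_inner_measurable_M [measurable]: "(\<lambda>\<omega>. S m \<omega> \<bullet> u) \<in> borel_measurable M"
proof -
  have "(\<lambda>\<omega>. \<Sum>k=1..m. \<sigma> k \<omega> \<bullet> u) \<in> borel_measurable M"
    using step_measurable by (intro borel_measurable_sum borel_measurable_inner) auto
  then show ?thesis by (rule measurable_cong[THEN iffD1, rotated]) (simp add: S_inner)
qed

lemma first_moment_of_step: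
  assumes f: "bounded_at n f"
  shows "expectation (\<lambda>\<omega>. f \<omega> * (\<sigma> (Suc (Suc n)) \<omega> \<bullet> u)) =
    a / real (Suc n) * expectation (\<lambda>\<omega>. f \<omega> * (S (Suc n) \<omega> \<bullet> u))"
proof -
  have "expectation (\<lambda>\<omega>. f \<omega> * (\<sigma> (Suc (Suc n)) \<omega> \<bullet> u)) =
    expectation (\<lambda>\<omega>. f \<omega> * (q * (\<Sum>v\<in>unit_steps. v \<bullet> u) + a / real (Suc n) * (\<Sum>k=1..Suc n. \<sigma> k \<omega> \<bullet> u)))"
    by (rule step_expectation[OF f, of "\<lambda>v. v \<bullet> u"]) measurable
  also have "\<dots> = expectation (\<lambda>\<omega>. a / real (Suc n) * (f \<omega> * (S (Suc n) \<omega> \<bullet> u)))"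
    by (intro Bochner_Integration.integral_cong refl)
       (simp only: S_inner sum_unit_steps_inner mult_ac mult_zero_right mult_zero_left add_0)
  finally show ?thesis by simp
qed

lemma second_moment_of_step:
  assumes u: "u \<in> unit_steps" and f: "bounded_at n f"
  shows "expectation (\<lambda>\<omega>. f \<omega> * (\<sigma> (Suc (Suc n)) \<omega> \<bullet> u)\<^sup>2) =
    expectation (\<lambda>\<omega>. f \<omega> * (2 * q + a / real (Suc n) * energy u (Suc n) \<omega>))"
proof -
  have "expectation (\<lambda>\<omega>. f \<omega> * (\<sigma> (Suc (Suc n)) \<omega> \<bullet> u)\<^sup>2) =
    expectation (\<lambda>\<omega>. f \<omega> * (q * (\<Sum>v\<in>unit_steps. (v \<bullet> u)\<^sup>2) + a / real (Suc n) * (\<Sum>k=1..Suc n. (\<sigma> k \<omega> \<bullet> u)\<^sup>2)))"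
    by (rule step_expectation[OF f, of "\<lambda>v. (v \<bullet> u)\<^sup>2"]) measurable
  then show ?thesis by (simp only: energy_def sum_unit_steps_inner_square[OF u] mult.commute[of q 2])
qed

lemma bounded_at_next_step:
  assumes "u \<in> unit_steps"
  shows "bounded_at (Suc n) (\<lambda>\<omega>. \<sigma> (Suc (Suc n)) \<omega> \<bullet> u)"
proof (rule bounded_atI)
  show "(\<lambda>\<omega>. \<sigma> (Suc (Suc n)) \<omega> \<bullet> u) \<in> borel_measurable (past (Suc n))"
    using step_measurable_past[of "Suc (Suc n)" "Suc n"] by (intro borel_measurable_inner) auto
  show "AE \<omega> in M. \<bar>\<sigma> (Suc (Suc n)) \<omega> \<bullet> u\<bar> \<le> 1"
    using AE_inner_unit_steps[OF assms, of "Suc (Suc n)"] by eventually_elim force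
qed

lemma first_moment:
  assumes u: "u \<in> unit_steps" and f: "bounded_at n f"
  shows "expectation (\<lambda>\<omega>. f \<omega> * (S (Suc (Suc n)) \<omega> \<bullet> u)) =
    (1 + a / real (Suc n)) * expectation (\<lambda>\<omega>. f \<omega> * (S (Suc n) \<omega> \<bullet> u))"
proof -
  have "expectation (\<lambda>\<omega>. f \<omega> * (S (Suc (Suc n)) \<omega> \<bullet> u)) =
    expectation (\<lambda>\<omega>. f \<omega> * (S (Suc n) \<omega> \<bullet> u) + f \<omega> * (\<sigma> (Suc (Suc n)) \<omega> \<bullet> u))"
    by (intro Bochner_Integration.integral_cong refl) (simp add: S_Suc inner_add_left distrib_left)
  also have "\<dots> = expectation (\<lambda>\<omega>. f \<omega> * (S (Suc n) \<omega> \<bullet> u)) + expectation (\<lambda>\<omega>. f \<omega> * (\<sigma> (Suc (Suc n)) \<omega> \<bullet> u))"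
    using f bounded_at_S_inner[OF u, of n] bounded_at_next_step[OF u, of n] bounded_at_mono[of n "Suc n"]
    by (intro Bochner_Integration.integral_add bounded_at_integrable[of "Suc n"]) auto
  finally show ?thesis unfolding first_moment_of_step[OF f] by (simp add: distrib_right)
qed

lemma second_moment:
  assumes u: "u \<in> unit_steps" and f: "bounded_at n f"
  shows "expectation (\<lambda>\<omega>. f \<omega> * (S (Suc (Suc n)) \<omega> \<bullet> u)\<^sup>2) =
    (1 + 2 * a / real (Suc n)) * expectation (\<lambda>\<omega>. f \<omega> * (S (Suc n) \<omega> \<bullet> u)\<^sup>2)
    + expectation (\<lambda>\<omega>. f \<omega> * (2 * q + a / real (Suc n) * energy u (Suc n) \<omega>))"
proof -
  let ?X = "\<lambda>\<omega>. S (Suc n) \<omega> \<bullet> u" and ?s = "\<lambda>\<omega>. \<sigma> (Suc (Suc n)) \<omega> \<bullet> u"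
  have b: "bounded_at (Suc n) f" "bounded_at (Suc n) ?X" "bounded_at (Suc n) ?s"
    using f bounded_at_S_inner[OF u, of n] bounded_at_next_step[OF u, of n] bounded_at_mono[of n "Suc n"] by auto
  have fX: "bounded_at n (\<lambda>\<omega>. 2 * f \<omega> * ?X \<omega>)" using f bounded_at_S_inner[OF u, of n] by auto
  have "bounded_at (Suc n) (\<lambda>\<omega>. f \<omega> * (?X \<omega>)\<^sup>2)" "bounded_at (Suc n) (\<lambda>\<omega>. 2 * f \<omega> * ?X \<omega> * ?s \<omega>)"
    "bounded_at (Suc n) (\<lambda>\<omega>. f \<omega> * (?s \<omega>)\<^sup>2)"
    using b by auto
  note i = this[THEN bounded_at_integrable]
  have "expectation (\<lambda>\<omega>. f \<omega> * (S (Suc (Suc n)) \<omega> \<bullet> u)\<^sup>2) =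
    expectation (\<lambda>\<omega>. f \<omega> * (?X \<omega>)\<^sup>2 + 2 * f \<omega> * ?X \<omega> * ?s \<omega> + f \<omega> * (?s \<omega>)\<^sup>2)"
    by (intro Bochner_Integration.integral_cong refl)
       (simp add: S_Suc inner_add_left power2_eq_square algebra_simps)
  also have "\<dots> = expectation (\<lambda>\<omega>. f \<omega> * (?X \<omega>)\<^sup>2) + expectation (\<lambda>\<omega>. 2 * f \<omega> * ?X \<omega> * ?s \<omega>)
      + expectation (\<lambda>\<omega>. f \<omega> * (?s \<omega>)\<^sup>2)"
    using i by (simp only: Bochner_Integration.integral_add Bochner_Integration.integrable_add)
  also have "expectation (\<lambda>\<omega>. 2 * f \<omega> * ?X \<omega> * ?s \<omega>) = 2 * a / real (Suc n) * expectation (\<lambda>\<omega>. f \<omega> * (?X \<omega>)\<^sup>2)"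
  proof -
    have "expectation (\<lambda>\<omega>. 2 * f \<omega> * ?X \<omega> * ?X \<omega>) = expectation (\<lambda>\<omega>. 2 * (f \<omega> * (?X \<omega>)\<^sup>2))"
      by (intro Bochner_Integration.integral_cong refl) (simp add: power2_eq_square)
    then show ?thesis unfolding first_moment_of_step[OF fX] by simp
  qed
  finally show ?thesis unfolding second_moment_of_step[OF u f] by (simp add: distrib_right)
qed

end

section \<open>Normalisation and direction\<close>

definition growth :: "real \<Rightarrow> nat \<Rightarrow> real" where
  "growth b n = (\<Prod>k=1..n. 1 + b / real k)"

lemma growth_0 [simp]: "growth b 0 = 1"
  by (simp add: growth_def)

lemma growth_Suc: "growth b (Suc n) = (1 + b / real (Suc n)) * growth b n"
  by (simp add: growth_def mult.commute)

lemma growth_ge_1: "0 \<le> b \<Longrightarrow> 1 \<le> growth b n"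
  unfolding growth_def by (rule prod_ge_1) simp

lemma growth_pos: "0 \<le> b \<Longrightarrow> 0 < growth b n"
  using growth_ge_1[of b n] by linarith

lemma growth_le_Suc:
  assumes "0 \<le> b" shows "growth b n \<le> growth b (Suc n)"
proof -
  have "1 * growth b n \<le> (1 + b / real (Suc n)) * growth b n"
    using assms growth_pos[OF assms, of n] by (intro mult_right_mono) auto
  then show ?thesis by (simp add: growth_Suc)
qed

text \<open>
At \<open>b = 1/2\<close> the squared growth is at most linear, so that its inverse is not summable. The
slope \<open>2\<close> leaves room for the quadratic term of each factor.
\<close>

lemma growth_square_le:
  assumes "0 \<le> b" "b \<le> 1 / 2"
  shows "(growth b n)\<^sup>2 \<le> 2 * real n + 1"
proof (induction n)
  case (Suc n)
  define m where "m = real (Suc n)"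
  have m: "m > 0" "2 * real n + 1 = 2 * m - 1" by (auto simp: m_def)
  have "(growth b (Suc n))\<^sup>2 = (1 + b / m)\<^sup>2 * (growth b n)\<^sup>2"
    by (simp only: growth_Suc power_mult_distrib m_def)
  also have "\<dots> \<le> (1 + (1 / 2) / m)\<^sup>2 * (2 * m - 1)"
    using Suc assms m by (intro mult_mono power_mono add_left_mono divide_right_mono) auto
  also have "\<dots> = 2 * m + 1 - 1 / (2 * m) - 1 / (4 * m\<^sup>2)"
    using m(1) by (simp add: power2_eq_square field_simps)
  also have "\<dots> \<le> 2 * m + 1"
  proof -
    have "0 \<le> 1 / (2 * m)" "0 \<le> 1 / (4 * m\<^sup>2)" using m(1) by simp_all
    then show ?thesis by linarith
  qed
  finally show ?case by (simp add: m_def)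
qed simp

text \<open>
The sequence \<open>(n + 1) / (growth b n)\<^sup>2\<close> decreases in each step by at least
\<open>(2 b - 1) / (growth b (n + 1))\<^sup>2\<close>, so the partial sums telescope.
\<close>

lemma summable_inverse_growth_square:
  assumes "1 / 2 < b"
  shows "summable (\<lambda>n. 1 / (growth b (Suc n))\<^sup>2)"
proof (rule summableI_nonneg_bounded)
  fix n
  have b: "0 \<le> b" using assms by simp
  have step: "(2 * b - 1) * (1 / (growth b (Suc k))\<^sup>2)
      \<le> real (Suc k) / (growth b k)\<^sup>2 - real (Suc (Suc k)) / (growth b (Suc k))\<^sup>2" for k
  proof -
    define m where "m = real (Suc k)"
    have m: "m > 0" by (simp add: m_def)
    have "0 < 1 + b / m" using b m by (simp add: add_pos_nonneg)
    then have "m / (growth b k)\<^sup>2 = m * (1 + b / m)\<^sup>2 / (growth b (Suc k))\<^sup>2"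
      by (simp add: growth_Suc m_def power_mult_distrib)
    moreover have "m * (1 + b / m)\<^sup>2 - (m + 1) = 2 * b - 1 + b\<^sup>2 / m"
      using m by (simp add: power2_eq_square field_simps)
    ultimately have "m / (growth b k)\<^sup>2 - (m + 1) / (growth b (Suc k))\<^sup>2
        = (2 * b - 1 + b\<^sup>2 / m) / (growth b (Suc k))\<^sup>2"
      by (simp add: diff_divide_distrib[symmetric])
    moreover have "(2 * b - 1) * (1 / (growth b (Suc k))\<^sup>2) \<le> (2 * b - 1 + b\<^sup>2 / m) / (growth b (Suc k))\<^sup>2"
      using m by (simp add: divide_right_mono)
    ultimately show ?thesis by (simp add: m_def add.commute)
  qed
  have "(2 * b - 1) * (\<Sum>k<n. 1 / (growth b (Suc k))\<^sup>2) \<le> 1 - real (Suc n) / (growth b n)\<^sup>2"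
  proof (induction n)
    case (Suc n)
    then show ?case using step[of n] unfolding sum.lessThan_Suc distrib_left by linarith
  qed simp
  also have "\<dots> \<le> 1" by simp
  finally show "(\<Sum>k<n. 1 / (growth b (Suc k))\<^sup>2) \<le> 1 / (2 * b - 1)"
    using assms by (simp add: field_simps)
qed simp

lemma direction_convergesI:
  fixes s :: "nat \<Rightarrow> real ^ 'd :: finite"
  assumes g: "\<And>n. 0 < g n" and lim: "(\<lambda>n. s (Suc n) /\<^sub>R g n) \<longlonglongrightarrow> L" and "L \<noteq> 0"
  shows "direction_converges s"
proof -
  have "(\<lambda>n. sgn (s (Suc n) /\<^sub>R g n)) \<longlonglongrightarrow> sgn L" using lim \<open>L \<noteq> 0\<close> by (rule tendsto_sgn)
  moreover have "sgn (s (Suc n) /\<^sub>R g n) = s (Suc n) /\<^sub>R norm (s (Suc n))" for n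
    using g[of n] by (simp add: sgn_scaleR) (simp add: sgn_div_norm)
  ultimately have "(\<lambda>n. s (Suc n) /\<^sub>R norm (s (Suc n))) \<longlonglongrightarrow> sgn L" by simp
  then have "(\<lambda>n. s n /\<^sub>R norm (s n)) \<longlonglongrightarrow> sgn L" by (rule LIMSEQ_imp_Suc)
  then show ?thesis
    unfolding direction_converges_def using \<open>L \<noteq> 0\<close> by (intro bexI[of _ "sgn L"]) (simp_all add: norm_sgn)
qed

lemma direction_converges_imp_positive:
  fixes s :: "nat \<Rightarrow> real ^ 'd :: finite"
  assumes "direction_converges s"
  shows "\<exists>u\<in>unit_steps. \<forall>\<^sub>F n in sequentially. 0 < s n \<bullet> u"
proof -
  obtain L where L: "norm L = 1" "(\<lambda>n. s n /\<^sub>R norm (s n)) \<longlonglongrightarrow> L"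
    using assms by (auto simp: direction_converges_def)
  then have "L \<noteq> 0" by auto
  then obtain i where i: "L $ i \<noteq> 0" by (auto simp: vec_eq_iff)
  define u :: "real ^ 'd" where "u = (if L $ i > 0 then axis i 1 else - axis i 1)"
  have u: "u \<in> unit_steps" by (simp add: u_def unit_steps_def)
  have "0 < L \<bullet> u" using i by (auto simp: u_def cart_eq_inner_axis[symmetric] not_less)
  moreover have "(\<lambda>n. (s n /\<^sub>R norm (s n)) \<bullet> u) \<longlonglongrightarrow> L \<bullet> u" by (intro tendsto_intros L)
  ultimately have "\<forall>\<^sub>F n in sequentially. 0 < (s n /\<^sub>R norm (s n)) \<bullet> u" by (rule order_tendstoD(1)[rotated])
  then have "\<forall>\<^sub>F n in sequentially. 0 < s n \<bullet> u"
  proof eventually_elim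
    case (elim n)
    then have "0 < inverse (norm (s n)) * (s n \<bullet> u)" by simp
    then show ?case by (smt (verit) inverse_nonnegative_iff_nonnegative norm_ge_zero zero_less_mult_iff)
  qed
  with u show ?thesis by blast
qed

text \<open>
This form mentions no existential quantifier over the sphere, and the event is therefore
measurable.
\<close>

lemma direction_converges_iff:
  fixes s :: "nat \<Rightarrow> real ^ 'd :: finite"
  shows "direction_converges s \<longleftrightarrow>
    Cauchy (\<lambda>n. s n /\<^sub>R norm (s n)) \<and> norm (lim (\<lambda>n. s n /\<^sub>R norm (s n))) = 1"
proof
  assume "direction_converges s"
  then obtain L where L: "norm L = 1" "(\<lambda>n. s n /\<^sub>R norm (s n)) \<longlonglongrightarrow> L"
    by (auto simp: direction_converges_def)
  then show "Cauchy (\<lambda>n. s n /\<^sub>R norm (s n)) \<and> norm (lim (\<lambda>n. s n /\<^sub>R norm (s n))) = 1"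
    using LIMSEQ_imp_Cauchy[OF L(2)] limI[OF L(2)] by simp
next
  assume *: "Cauchy (\<lambda>n. s n /\<^sub>R norm (s n)) \<and> norm (lim (\<lambda>n. s n /\<^sub>R norm (s n))) = 1"
  then have "(\<lambda>n. s n /\<^sub>R norm (s n)) \<longlonglongrightarrow> lim (\<lambda>n. s n /\<^sub>R norm (s n))"
    unfolding Cauchy_convergent_iff convergent_LIMSEQ_iff by (rule conjunct1)
  with * show "direction_converges s" unfolding direction_converges_def by auto
qed

context elephant_random_walk
begin

lemma q_le_1: "q \<le> 1"
proof -
  have "1 - p \<le> 2 * real CARD('d) - 1"
  proof -
    have "1 \<le> real CARD('d)" by (simp add: Suc_leI)
    moreover have "0 \<le> p" using p_range by simp
    ultimately show ?thesis by linarith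
  qed
  then show ?thesis unfolding q_def using denominator_pos by (simp add: divide_le_eq)
qed

lemma a_range: "-1 \<le> a" "a \<le> 1"
  using q_le_1 q_nonneg p_range by (auto simp: a_def)

lemma a_eq: "(2 * real CARD('d) - 1) * a = 2 * real CARD('d) * p - 1"
proof -
  have "(2 * real CARD('d) - 1) * q = 1 - p" using total_mass by (simp add: a_def algebra_simps)
  then show ?thesis by (simp add: a_def algebra_simps)
qed

lemma p_crit_iff: "p_crit CARD('d) < p \<longleftrightarrow> 1 / 2 < a"
proof -
  have "0 < real CARD('d)" by simp
  then have "p_crit CARD('d) < p \<longleftrightarrow> 2 * real CARD('d) + 1 < p * (4 * real CARD('d))"
    unfolding p_crit_def by (simp add: divide_less_eq)
  also have "\<dots> \<longleftrightarrow> (2 * real CARD('d) - 1) * (1 / 2) < (2 * real CARD('d) - 1) * a"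
    unfolding a_eq by (simp add: algebra_simps) linarith
  also have "\<dots> \<longleftrightarrow> 1 / 2 < a" using denominator_pos by (rule mult_less_cancel_left_pos)
  finally show ?thesis .
qed

lemma S_measurable [measurable]: "S m \<in> borel_measurable M"
proof -
  have "(\<lambda>\<omega>. \<Sum>k=1..m. \<sigma> k \<omega>) \<in> borel_measurable M"
    using step_measurable by (intro borel_measurable_sum) auto
  moreover have "(\<Sum>k=1..m. \<sigma> k \<omega>) = S m \<omega>" if "\<omega> \<in> space M" for \<omega>
    by (induction m) (use that in \<open>auto simp: S_0 S_Suc\<close>)
  ultimately show ?thesis by (rule measurable_cong[THEN iffD1, rotated])
qed

lemma direction_converges_measurable: "{\<omega> \<in> space M. direction_converges (\<lambda>n. S n \<omega>)} \<in> sets M"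
  unfolding direction_converges_iff by measurable

section \<open>The superdiffusive regime\<close>

lemma superdiffusive_martingale:
  assumes a: "1 / 2 < a" and u: "u \<in> unit_steps"
  shows "bounded_martingale M past (\<lambda>n \<omega>. (S (Suc n) \<omega> \<bullet> u) / growth a n) (\<lambda>n. 2 / growth a (Suc n))"
proof
  fix n
  have a0: "0 \<le> a" using a by simp
  note gp = growth_pos[OF a0]
  have r: "0 < 1 + a / real (Suc n)" using a0 by (simp add: add_pos_nonneg)
  have Y_eq: "x / growth a n = (1 + a / real (Suc n)) * x / growth a (Suc n)" for x
    using r gp[of n] by (simp add: growth_Suc)
  show "bounded_at n (\<lambda>\<omega>. (S (Suc n) \<omega> \<bullet> u) / growth a n)"
    using bounded_at_S_inner[OF u] by auto
  show "expectation (\<lambda>\<omega>. f \<omega> * ((S (Suc (Suc n)) \<omega> \<bullet> u) / growth a (Suc n))) =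
      expectation (\<lambda>\<omega>. f \<omega> * ((S (Suc n) \<omega> \<bullet> u) / growth a n))" if f: "bounded_at n f" for f
  proof -
    have "f \<omega> * ((S (Suc n) \<omega> \<bullet> u) / growth a n)
      = (1 + a / real (Suc n)) / growth a (Suc n) * (f \<omega> * (S (Suc n) \<omega> \<bullet> u))" for \<omega>
      unfolding Y_eq by simp
    then show ?thesis using first_moment[OF u f] by simp
  qed
  show "AE \<omega> in M. \<bar>(S (Suc (Suc n)) \<omega> \<bullet> u) / growth a (Suc n) - (S (Suc n) \<omega> \<bullet> u) / growth a n\<bar> \<le> 2 / growth a (Suc n)"
    using AE_inner_unit_steps[OF u, of "Suc (Suc n)"] AE_abs_S_inner_le[OF u, of "Suc n"] AE_space
  proof eventually_elim
    case (elim \<omega>)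
    define x where "x = S (Suc n) \<omega> \<bullet> u"
    define e where "e = \<sigma> (Suc (Suc n)) \<omega> \<bullet> u"
    have "\<bar>a / real (Suc n) * x\<bar> = a * (\<bar>x\<bar> / real (Suc n))" using a0 by (simp add: abs_mult)
    also have "\<dots> \<le> 1 * 1" using elim(2) a_range a0 by (intro mult_mono) (auto simp: x_def)
    finally have "\<bar>a / real (Suc n) * x\<bar> \<le> 1" by simp
    moreover have "\<bar>e\<bar> \<le> 1" using elim(1) by (force simp: e_def)
    ultimately have "\<bar>e - a / real (Suc n) * x\<bar> \<le> 2" by linarith
    moreover have "(S (Suc (Suc n)) \<omega> \<bullet> u) / growth a (Suc n) - (S (Suc n) \<omega> \<bullet> u) / growth a n
      = (e - a / real (Suc n) * x) / growth a (Suc n)"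
      unfolding Y_eq[of "S (Suc n) \<omega> \<bullet> u"] diff_divide_distrib[symmetric]
      using elim(3) by (simp add: S_Suc inner_add_left x_def e_def algebra_simps)
    ultimately show ?case using gp[of "Suc n"] by (simp add: abs_divide divide_right_mono)
  qed
  show "0 < 2 / growth a (Suc n)" using gp by simp
  show "summable (\<lambda>n. (2 / growth a (Suc n))\<^sup>2)"
    using summable_mult[OF summable_inverse_growth_square[OF a], of 4] by (simp add: power_divide)
qed

text \<open>
The conditional variance of a step is \<open>2 q + a E / m - (a X / m)\<^sup>2\<close>, with \<open>E\<close> the energy. By
the Cauchy--Schwarz inequality \<open>X\<^sup>2 \<le> m E\<close>, and as \<open>a \<le> 1\<close> the last two terms together are
nonnegative.
\<close>

lemma superdiffusive_nondegenerate:
  assumes a: "1 / 2 < a" and "0 < q" and u: "u \<in> unit_steps"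
  shows "nondegenerate_martingale M past (\<lambda>n \<omega>. (S (Suc n) \<omega> \<bullet> u) / growth a n) (\<lambda>n. 2 / growth a (Suc n)) (q / 2)"
proof -
  let ?X = "\<lambda>n \<omega>. S n \<omega> \<bullet> u"
  let ?Y = "\<lambda>n \<omega>. (S (Suc n) \<omega> \<bullet> u) / growth a n"
  interpret Y: bounded_martingale M past ?Y "\<lambda>n. 2 / growth a (Suc n)"
    using a u by (rule superdiffusive_martingale)
  show ?thesis
  proof
    show "0 < q / 2" "q / 2 \<le> 1" using \<open>0 < q\<close> q_le_1 by auto
    fix n f assume f: "bounded_at n f" and f0: "\<And>\<omega>. 0 \<le> f \<omega>"
    define m where "m = real (Suc n)"
    define g where "g = growth a (Suc n)"
    have a0: "0 \<le> a" using a by simp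
    have m: "0 < m" and g: "0 < g" by (auto simp: m_def g_def growth_pos[OF a0])
    have r: "0 < 1 + a / m" using a0 m by (simp add: add_pos_nonneg)
    have bX: "bounded_at n (?X (Suc n))" by (rule bounded_at_S_inner[OF u])
    have bE: "bounded_at n (energy u (Suc n))" by (rule bounded_at_energy[OF u])
    have Y_n: "?Y n \<omega> = (1 + a / m) / g * ?X (Suc n) \<omega>" for \<omega>
      using r growth_pos[OF a0, of n] by (simp add: g_def m_def growth_Suc)
    have "expectation (\<lambda>\<omega>. f \<omega> * (?Y (Suc n) \<omega>)\<^sup>2) =
        expectation (\<lambda>\<omega>. f \<omega> * (?Y n \<omega>)\<^sup>2) + expectation (\<lambda>\<omega>. f \<omega> * (?Y (Suc n) \<omega> - ?Y n \<omega>)\<^sup>2)"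
      using Y.square_step[OF f Y.bounded[of n]] by simp
    moreover have "expectation (\<lambda>\<omega>. f \<omega> * (?Y (Suc n) \<omega>)\<^sup>2) =
        ((1 + 2 * a / m) * expectation (\<lambda>\<omega>. f \<omega> * (?X (Suc n) \<omega>)\<^sup>2)
          + expectation (\<lambda>\<omega>. f \<omega> * (2 * q + a / m * energy u (Suc n) \<omega>))) / g\<^sup>2"
      using second_moment[OF u f] by (simp add: power_divide g_def m_def)
    moreover have "expectation (\<lambda>\<omega>. f \<omega> * (?Y n \<omega>)\<^sup>2) = (1 + a / m)\<^sup>2 * expectation (\<lambda>\<omega>. f \<omega> * (?X (Suc n) \<omega>)\<^sup>2) / g\<^sup>2"
    proof -
      have "f \<omega> * (?Y n \<omega>)\<^sup>2 = (1 + a / m)\<^sup>2 / g\<^sup>2 * (f \<omega> * (?X (Suc n) \<omega>)\<^sup>2)" for \<omega>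
        unfolding Y_n by (simp only: power_mult_distrib power_divide mult_ac)
      then show ?thesis by simp
    qed
    moreover have "(1 + a / m)\<^sup>2 = 1 + 2 * a / m + (a / m)\<^sup>2"
      by (simp add: power2_eq_square algebra_simps)
    ultimately have "expectation (\<lambda>\<omega>. f \<omega> * (?Y (Suc n) \<omega> - ?Y n \<omega>)\<^sup>2) =
      (expectation (\<lambda>\<omega>. f \<omega> * (2 * q + a / m * energy u (Suc n) \<omega>))
        - (a / m)\<^sup>2 * expectation (\<lambda>\<omega>. f \<omega> * (?X (Suc n) \<omega>)\<^sup>2)) / g\<^sup>2"
      by (simp add: diff_divide_distrib add_divide_distrib algebra_simps)
    also have "\<dots> = expectation (\<lambda>\<omega>. f \<omega> * (2 * q + a / m * energy u (Suc n) \<omega>)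
        - (a / m)\<^sup>2 * (f \<omega> * (?X (Suc n) \<omega>)\<^sup>2)) / g\<^sup>2"
      using f bX bE by (subst Bochner_Integration.integral_diff) (auto intro!: bounded_at_integrable[of n])
    also have "\<dots> \<ge> expectation (\<lambda>\<omega>. 2 * q * f \<omega>) / g\<^sup>2"
    proof (intro divide_right_mono integral_mono_AE)
      show "AE \<omega> in M. 2 * q * f \<omega> \<le> f \<omega> * (2 * q + a / m * energy u (Suc n) \<omega>)
        - (a / m)\<^sup>2 * (f \<omega> * (?X (Suc n) \<omega>)\<^sup>2)"
        using AE_energy_bounds[OF u, of "Suc n"]
      proof eventually_elim
        case (elim \<omega>)
        define e where "e = energy u (Suc n) \<omega>"
        have "(a / m)\<^sup>2 * (?X (Suc n) \<omega>)\<^sup>2 \<le> (a / m)\<^sup>2 * (m * e)"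
          using elim by (intro mult_left_mono) (auto simp: m_def e_def)
        also have "\<dots> = a * (a * e / m)" using m by (simp add: power2_eq_square)
        also have "\<dots> \<le> 1 * (a * e / m)"
          using a_range a0 elim m by (intro mult_right_mono) (auto simp: e_def)
        finally have "f \<omega> * (2 * q) \<le> f \<omega> * (2 * q + a / m * e - (a / m)\<^sup>2 * (?X (Suc n) \<omega>)\<^sup>2)"
          by (intro mult_left_mono f0) simp
        then show ?case by (simp add: e_def algebra_simps)
      qed
      show "integrable M (\<lambda>\<omega>. 2 * q * f \<omega>)"
        "integrable M (\<lambda>\<omega>. f \<omega> * (2 * q + a / m * energy u (Suc n) \<omega>) - (a / m)\<^sup>2 * (f \<omega> * (?X (Suc n) \<omega>)\<^sup>2))"
        using f bX bE by (auto intro!: bounded_at_integrable[of n])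
    qed simp
    finally show "q / 2 * (2 / growth a (Suc n))\<^sup>2 * expectation f
      \<le> expectation (\<lambda>\<omega>. f \<omega> * (?Y (Suc n) \<omega> - ?Y n \<omega>)\<^sup>2)"
      by (simp add: g_def power_divide)
  qed
qed

text \<open>
For \<open>p = 1\<close> the variance of the steps vanishes and gives no lower bound, but the expected position already
attains the largest possible value \<open>n + 1\<close>, which forces the walk.
\<close>

lemma perfect_memory_limit:
  assumes "p = 1"
  shows "AE \<omega> in M. \<forall>n. (S (Suc n) \<omega> \<bullet> axis i1 1) / growth a n = 1"
proof -
  define u :: "real ^ 'd" where "u = axis i1 1"
  have u: "u \<in> unit_steps" by (simp add: u_def unit_steps_def)
  have "q = 0" by (subst q_def) (simp add: assms)
  then have "a = 1" using a_def assms by linarith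
  have g: "growth a n = real (Suc n)" for n
    by (induction n) (auto simp: growth_Suc \<open>a = 1\<close> field_simps)
  have E: "expectation (\<lambda>\<omega>. S (Suc n) \<omega> \<bullet> u) = real (Suc n)" for n
  proof (induction n)
    case 0
    have "expectation (\<lambda>\<omega>. S (Suc 0) \<omega> \<bullet> u) = expectation (\<lambda>_. 1)"
      using step_1 by (intro Bochner_Integration.integral_cong refl)
        (simp add: S_Suc S_0 u_def inner_axis_axis)
    then show ?case by (simp add: prob_space)
  next
    case (Suc n)
    have "expectation (\<lambda>\<omega>. S (Suc (Suc n)) \<omega> \<bullet> u) = (1 + 1 / real (Suc n)) * real (Suc n)"
      using first_moment[OF u bounded_at_const[of n 1]] unfolding mult_1_left Suc.IH \<open>a = 1\<close> .
    also have "\<dots> = real (Suc (Suc n))" by (simp add: field_simps)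
    finally show ?case .
  qed
  have "AE \<omega> in M. S (Suc n) \<omega> \<bullet> u = real (Suc n)" for n
  proof -
    have i: "integrable M (\<lambda>\<omega>. S (Suc n) \<omega> \<bullet> u)"
      using bounded_at_S_inner[OF u] by (rule bounded_at_integrable)
    have "AE \<omega> in M. 0 \<le> real (Suc n) - S (Suc n) \<omega> \<bullet> u"
      using AE_abs_S_inner_le[OF u, of "Suc n"] by eventually_elim linarith
    moreover have "expectation (\<lambda>\<omega>. real (Suc n) - S (Suc n) \<omega> \<bullet> u) = 0"
      using i E[of n] by (subst Bochner_Integration.integral_diff) (auto simp: prob_space)
    ultimately have "AE \<omega> in M. real (Suc n) - S (Suc n) \<omega> \<bullet> u = 0"
      using i by (subst (asm) integral_nonneg_eq_0_iff_AE) auto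
    then show ?thesis by eventually_elim simp
  qed
  then have "AE \<omega> in M. \<forall>n. S (Suc n) \<omega> \<bullet> u = real (Suc n)" by (subst AE_all_countable) blast
  then show ?thesis unfolding g u_def by eventually_elim simp
qed

lemma superdiffusive_limit_nonzero:
  assumes a: "1 / 2 < a"
  shows "AE \<omega> in M. lim (\<lambda>n. (S (Suc n) \<omega> \<bullet> axis i1 1) / growth a n) \<noteq> 0"
proof (cases "p = 1")
  case True
  show ?thesis using perfect_memory_limit[OF True]
  proof eventually_elim
    case (elim \<omega>)
    then have "(\<lambda>n. (S (Suc n) \<omega> \<bullet> axis i1 1) / growth a n) \<longlonglongrightarrow> 1" by (simp only: tendsto_const)
    then show ?case by (simp add: limI)
  qed
next
  case False
  then have "0 < q" unfolding q_def using p_range denominator_pos by (intro divide_pos_pos) auto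
  interpret Y: nondegenerate_martingale M past "\<lambda>n \<omega>. (S (Suc n) \<omega> \<bullet> axis i1 1) / growth a n"
    "\<lambda>n. 2 / growth a (Suc n)" "q / 2"
    using a \<open>0 < q\<close> by (rule superdiffusive_nondegenerate) (simp add: unit_steps_def)
  show ?thesis using Y.limit_nonzero by (simp add: Y.Y_lim_def)
qed

theorem superdiffusive_direction_converges:
  assumes a: "1 / 2 < a"
  shows "AE \<omega> in M. direction_converges (\<lambda>n. S n \<omega>)"
proof -
  have "AE \<omega> in M. convergent (\<lambda>n. (S (Suc n) \<omega> \<bullet> axis i 1) / growth a n)" for i
  proof -
    interpret Y: bounded_martingale M past "\<lambda>n \<omega>. (S (Suc n) \<omega> \<bullet> axis i 1) / growth a n" "\<lambda>n. 2 / growth a (Suc n)"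
      using a by (rule superdiffusive_martingale) (simp add: unit_steps_def)
    show ?thesis by (rule Y.converges)
  qed
  then have "AE \<omega> in M. \<forall>i. convergent (\<lambda>n. (S (Suc n) \<omega> \<bullet> axis i 1) / growth a n)"
    by (subst AE_all_countable) blast
  with superdiffusive_limit_nonzero[OF a] show ?thesis
  proof eventually_elim
    case (elim \<omega>)
    define L where "L = (\<chi> i. lim (\<lambda>n. (S (Suc n) \<omega> \<bullet> axis i 1) / growth a n))"
    have "(\<lambda>n. S (Suc n) \<omega> /\<^sub>R growth a n) \<longlonglongrightarrow> L"
    proof (rule vec_tendstoI)
      fix i
      have "(\<lambda>n. (S (Suc n) \<omega> \<bullet> axis i 1) / growth a n) \<longlonglongrightarrow> L $ i"
        using elim(2) by (simp add: L_def convergent_LIMSEQ_iff)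
      then show "(\<lambda>n. (S (Suc n) \<omega> /\<^sub>R growth a n) $ i) \<longlonglongrightarrow> L $ i"
        by (simp add: cart_eq_inner_axis[symmetric] divide_inverse mult.commute)
    qed
    moreover have "L $ i1 \<noteq> 0" using elim(1) by (simp add: L_def)
    then have "L \<noteq> 0" by auto
    ultimately show ?case using growth_pos[of a] a by (intro direction_convergesI[of "growth a"]) auto
  qed
qed

section \<open>The critical and diffusive regimes\<close>

text \<open>
For \<open>a \<ge> 0\<close> the walk is normalised by \<open>growth a\<close>. For \<open>a < 0\<close> the drift already points towards
\<open>0\<close>, and the walk itself is used, which is the case \<open>b = 0\<close>. In both cases, while the
normalised coordinate lies in \<open>(0, K)\<close>, the drift takes at most an amount of order \<open>K\<^sup>2 / n\<close> per
step off the square, in unnormalised units, and the second moment of the step, at least \<open>v\<close>,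
prevails. Since the walk has integer coordinates,
a positive coordinate cannot become negative in a single step.
\<close>

lemma not_eventually_positive:
  assumes a: "a \<le> 1 / 2" and pq: "0 < q" "0 < p + q" and u: "u \<in> unit_steps"
  shows "AE \<omega> in M. \<not> (\<forall>\<^sub>F n in sequentially. 0 < S n \<omega> \<bullet> u)"
proof -
  define b where "b = max a 0"
  define v where "v = min (2 * q) (p + q)"
  define w where "w n = v / (2 * (2 * real n + 3))" for n
  let ?X = "\<lambda>n \<omega>. S n \<omega> \<bullet> u"
  let ?Y = "\<lambda>n \<omega>. ?X (Suc n) \<omega> / growth b n"
  have b: "0 \<le> b" "b \<le> 1 / 2" "a \<le> b" using a by (auto simp: b_def)
  have v: "0 < v" using pq by (simp add: v_def)
  note gp = growth_pos[OF b(1)]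
  note bX = bounded_at_S_inner[OF u]
  note bE = bounded_at_energy[OF u]
  have "AE \<omega> in M. \<not> (\<forall>\<^sub>F n in sequentially. 0 < ?Y n \<omega>)"
  proof (rule supermartingale_not_eventually_positive[where w = w])
    show "bounded_at n (?Y n)" for n using bX by auto
    show "AE \<omega> in M. 0 < ?Y n \<omega> \<longrightarrow> 0 \<le> ?Y (Suc n) \<omega> \<and> ?Y (Suc n) \<omega> \<le> ?Y n \<omega> + 1" for n
      using AE_inner_unit_steps[OF u, of "Suc (Suc n)"] AE_space
    proof eventually_elim
      case (elim \<omega>)
      define x where "x = ?X (Suc n) \<omega>"
      define e where "e = \<sigma> (Suc (Suc n)) \<omega> \<bullet> u"
      have "x \<in> \<int>"
        unfolding x_def S_inner[OF elim(2)] by (intro Ints_sum) (use elim(1) in force)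
      have e: "-1 \<le> e" "e \<le> 1" using elim(1) by (force simp: e_def)+
      have x': "?X (Suc (Suc n)) \<omega> = x + e"
        using elim(2) by (simp add: S_Suc inner_add_left x_def e_def)
      show ?case
      proof
        assume "0 < ?Y n \<omega>"
        then have "0 < x" using gp[of n] by (simp add: x_def zero_less_divide_iff)
        then have "1 \<le> x" using \<open>x \<in> \<int>\<close> by (auto elim!: Ints_cases)
        then have "0 \<le> ?Y (Suc n) \<omega>" unfolding x' using e gp[of "Suc n"] by simp
        moreover have "?Y (Suc n) \<omega> \<le> ?Y n \<omega> + 1"
        proof -
          have "(x + e) / growth b (Suc n) \<le> (x + 1) / growth b (Suc n)"
            using e gp[of "Suc n"] by (simp add: divide_right_mono)
          also have "\<dots> \<le> (x + 1) / growth b n"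
            using \<open>0 < x\<close> gp[of n] growth_le_Suc[OF b(1), of n] by (intro divide_left_mono) auto
          also have "\<dots> = x / growth b n + 1 / growth b n" by (rule add_divide_distrib)
          also have "\<dots> \<le> x / growth b n + 1"
            using growth_ge_1[OF b(1), of n] by simp
          finally show ?thesis unfolding x' x_def .
        qed
        ultimately show "0 \<le> ?Y (Suc n) \<omega> \<and> ?Y (Suc n) \<omega> \<le> ?Y n \<omega> + 1" ..
      qed
    qed
    show "expectation (\<lambda>\<omega>. indicator A \<omega> * ?Y (Suc n) \<omega>) \<le> expectation (\<lambda>\<omega>. indicator A \<omega> * ?Y n \<omega>)"
      if A: "A \<in> sets (past n)" and pos: "\<And>\<omega>. \<omega> \<in> A \<Longrightarrow> 0 < ?Y n \<omega>" for n A
    proof -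
      define x where "x = expectation (\<lambda>\<omega>. indicator A \<omega> * ?X (Suc n) \<omega>)"
      have r: "0 < 1 + b / real (Suc n)" using b(1) by (simp add: add_pos_nonneg)
      have "0 \<le> x"
        unfolding x_def
      proof (intro Bochner_Integration.integral_nonneg)
        show "0 \<le> indicator A \<omega> * ?X (Suc n) \<omega>" for \<omega>
          using pos[of \<omega>] gp[of n] by (cases "\<omega> \<in> A") (simp_all add: zero_less_divide_iff)
      qed
      then have "(1 + a / real (Suc n)) * x / growth b (Suc n) \<le> (1 + b / real (Suc n)) * x / growth b (Suc n)"
        using b(3) gp[of "Suc n"] by (intro divide_right_mono mult_right_mono) (auto intro!: divide_right_mono)
      also have "\<dots> = x / growth b n" using r gp[of n] by (simp add: growth_Suc)
      finally show ?thesis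
        using first_moment[OF u bounded_at_indicator[OF A]] by (simp add: x_def)
    qed
    show "0 \<le> w n" for n using v by (simp add: w_def)
    show "\<not> summable w"
    proof
      assume "summable w"
      then have "summable (\<lambda>n. 6 / v * w n)" by (rule summable_mult)
      then have "summable (\<lambda>n. 1 / real (Suc n))"
      proof (rule summable_comparison_test'[where N = 0])
        fix n
        have w_eq: "6 / v * w n = 3 / (2 * real n + 3)" using v by (simp add: w_def field_simps)
        show "norm (1 / real (Suc n)) \<le> 6 / v * w n" unfolding w_eq by (simp add: field_simps)
      qed
      then have "summable (\<lambda>n. inverse (real n))"
        by (subst (asm) summable_Suc_iff[of "\<lambda>n. 1 / real n"]) (simp add: inverse_eq_divide)
      then show False using not_summable_harmonic[where 'a = real] by simp
    qed
    fix K :: real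
    have "(\<lambda>n. 2 * K\<^sup>2 * inverse (real (Suc n))) \<longlonglongrightarrow> 2 * K\<^sup>2 * 0"
      by (intro tendsto_intros LIMSEQ_inverse_real_of_nat)
    then have "\<forall>\<^sub>F n in sequentially. 2 * K\<^sup>2 * inverse (real (Suc n)) < v / 2"
      using v by (intro order_tendstoD(2)) auto
    then show "\<forall>\<^sub>F n in sequentially. \<forall>A\<in>sets (past n). (\<forall>\<omega>\<in>A. 0 < ?Y n \<omega> \<and> ?Y n \<omega> < K) \<longrightarrow>
      expectation (\<lambda>\<omega>. indicator A \<omega> * (?Y n \<omega>)\<^sup>2) + w n * prob A
      \<le> expectation (\<lambda>\<omega>. indicator A \<omega> * (?Y (Suc n) \<omega>)\<^sup>2)"
    proof eventually_elim
      case (elim n)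
      show ?case
      proof (intro ballI impI)
        fix A assume A: "A \<in> sets (past n)" and range: "\<forall>\<omega>\<in>A. 0 < ?Y n \<omega> \<and> ?Y n \<omega> < K"
        define m where "m = real (Suc n)"
        define g where "g = growth b n"
        define g' where "g' = growth b (Suc n)"
        define x where "x = expectation (\<lambda>\<omega>. indicator A \<omega> * (?X (Suc n) \<omega>)\<^sup>2)"
        define \<delta> where "\<delta> = (1 + b / m)\<^sup>2 - (1 + 2 * a / m)"
        have m: "1 \<le> m" by (simp add: m_def)
        have g: "1 \<le> g" "0 < g" "0 < g'" using growth_ge_1[OF b(1)] gp by (auto simp: g_def g'_def)
        have g'_eq: "g' = (1 + b / m) * g" by (simp add: g_def g'_def m_def growth_Suc)
        have bA: "bounded_at n (indicator A)" using A by (rule bounded_at_indicator)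
        have AM: "A \<in> sets M" using A by (rule sets_F)
        have x_le: "x \<le> (K * g)\<^sup>2 * prob A"
        proof -
          have "x \<le> expectation (\<lambda>\<omega>. (K * g)\<^sup>2 * indicator A \<omega>)"
            unfolding x_def
          proof (intro integral_mono bounded_at_integrable[of n])
            show "indicator A \<omega> * (?X (Suc n) \<omega>)\<^sup>2 \<le> (K * g)\<^sup>2 * indicator A \<omega>" for \<omega>
            proof (cases "\<omega> \<in> A")
              case True
              then have "0 < ?Y n \<omega>" "?Y n \<omega> < K" using range by blast+
              then have "0 < ?X (Suc n) \<omega>" "?X (Suc n) \<omega> < K * g"
                using g(2) by (auto simp: g_def[symmetric] zero_less_divide_iff divide_less_eq)
              then show ?thesis using True by (simp add: power_mono)
            qed simp
          qed (use bA bX in auto)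
          then show ?thesis using AM by simp
        qed
        have x0: "0 \<le> x" unfolding x_def by simp
        have \<delta>_le: "\<delta> * g\<^sup>2 \<le> 2 / m"
        proof (cases "0 \<le> a")
          case True
          then have "b = a" by (simp add: b_def)
          have "\<delta> = a\<^sup>2 / m\<^sup>2" using m by (simp add: \<delta>_def \<open>b = a\<close> power2_eq_square field_simps)
          also have "a\<^sup>2 \<le> 1\<^sup>2" using True a by (intro power_mono) auto
          then have "a\<^sup>2 / m\<^sup>2 \<le> 1 / m\<^sup>2" by (simp add: divide_right_mono)
          finally have "\<delta> * g\<^sup>2 \<le> 1 / m\<^sup>2 * (2 * m)"
            using growth_square_le[OF b(1,2), of n] by (intro mult_mono) (auto simp: g_def m_def)
          then show ?thesis using m by (simp add: power2_eq_square)
        next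
          case False
          then have "b = 0" by (simp add: b_def)
          then have "g = 1" by (simp add: g_def growth_def)
          have "\<delta> = - 2 * a / m" by (simp add: \<delta>_def \<open>b = 0\<close>)
          also have "\<dots> \<le> 2 / m" using a_range m by (intro divide_right_mono) auto
          finally show ?thesis by (simp add: \<open>g = 1\<close>)
        qed
        \<comment> \<open>\<open>\<delta> x\<close> is what the square loses compared with a martingale of the same normalisation\<close>
        have drift: "\<delta> * x \<le> v / 2 * prob A"
        proof -
          have \<delta>0: "0 \<le> \<delta>"
          proof -
            have "a / m \<le> b / m" using b(3) m by (simp add: divide_right_mono)
            moreover have "(1 + b / m)\<^sup>2 = 1 + 2 * (b / m) + (b / m)\<^sup>2"
              by (simp add: power2_eq_square algebra_simps)
            moreover have "0 \<le> (b / m)\<^sup>2" by simp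
            moreover have "2 * a / m = 2 * (a / m)" by simp
            ultimately show ?thesis unfolding \<delta>_def by linarith
          qed
          have "\<delta> * x \<le> \<delta> * ((K * g)\<^sup>2 * prob A)" using x_le \<delta>0 by (rule mult_left_mono)
          also have "\<dots> = K\<^sup>2 * (\<delta> * g\<^sup>2) * prob A" by (simp add: power_mult_distrib)
          also have "\<dots> \<le> K\<^sup>2 * (2 / m) * prob A"
            using \<delta>_le by (intro mult_right_mono mult_left_mono) auto
          also have "K\<^sup>2 * (2 / m) = 2 * K\<^sup>2 * inverse (real (Suc n))"
            by (simp add: m_def divide_inverse)
          also have "\<dots> * prob A \<le> v / 2 * prob A"
            using less_imp_le[OF elim] measure_nonneg by (rule mult_right_mono)
          finally show ?thesis .
        qed
        have noise: "v * prob A \<le> expectation (\<lambda>\<omega>. indicator A \<omega> * (2 * q + a / m * energy u (Suc n) \<omega>))"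
        proof -
          have "expectation (\<lambda>\<omega>. v * indicator A \<omega>)
            \<le> expectation (\<lambda>\<omega>. indicator A \<omega> * (2 * q + a / m * energy u (Suc n) \<omega>))"
          proof (intro integral_mono_AE bounded_at_integrable[of n])
            show "AE \<omega> in M. v * indicator A \<omega> \<le> indicator A \<omega> * (2 * q + a / m * energy u (Suc n) \<omega>)"
              using AE_energy_bounds[OF u, of "Suc n"]
            proof eventually_elim
              case (elim \<omega>)
              define e where "e = energy u (Suc n) \<omega> / m"
              have e: "0 \<le> e" "e \<le> 1" using elim m by (auto simp: e_def m_def)
              have "v \<le> 2 * q + a * e"
              proof (cases "0 \<le> a")
                case True
                then show ?thesis using e by (simp add: v_def min_le_iff_disj)
              next
                case False
                then have "a * 1 \<le> a * e" using e by (intro mult_left_mono_neg) auto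
                then show ?thesis by (simp add: v_def a_def)
              qed
              then show ?case by (simp add: e_def indicator_def)
            qed
          qed (use bA bE in auto)
          then show ?thesis using AM by simp
        qed
        have w_le: "w n * g'\<^sup>2 \<le> v / 2"
        proof -
          have "w n * g'\<^sup>2 \<le> w n * (2 * real n + 3)"
            using growth_square_le[OF b(1,2), of "Suc n"] v by (intro mult_left_mono) (auto simp: g'_def w_def)
          also have "\<dots> = v / 2" by (simp add: w_def field_simps)
          finally show ?thesis .
        qed
        have "(expectation (\<lambda>\<omega>. indicator A \<omega> * (?Y n \<omega>)\<^sup>2) + w n * prob A) * g'\<^sup>2
          = (1 + b / m)\<^sup>2 * x + w n * g'\<^sup>2 * prob A"
        proof -
          have "expectation (\<lambda>\<omega>. indicator A \<omega> * (?Y n \<omega>)\<^sup>2) = x / g\<^sup>2"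
            by (simp add: x_def g_def power_divide)
          moreover have "x / g\<^sup>2 * g'\<^sup>2 = (1 + b / m)\<^sup>2 * x"
            unfolding g'_eq power_mult_distrib using g(2) by simp
          ultimately show ?thesis by (simp only: distrib_right) (simp only: mult_ac)
        qed
        also have "\<dots> \<le> (1 + 2 * a / m) * x + v * prob A"
        proof -
          have "(1 + b / m)\<^sup>2 * x = (1 + 2 * a / m) * x + \<delta> * x"
            unfolding \<delta>_def left_diff_distrib by simp
          moreover have "w n * g'\<^sup>2 * prob A \<le> v / 2 * prob A"
            using w_le measure_nonneg by (rule mult_right_mono)
          moreover have "v * prob A = v / 2 * prob A + v / 2 * prob A" by simp
          ultimately show ?thesis using drift by linarith
        qed
        also have "\<dots> \<le> (1 + 2 * a / m) * x
            + expectation (\<lambda>\<omega>. indicator A \<omega> * (2 * q + a / m * energy u (Suc n) \<omega>))"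
          using noise by simp
        also have "\<dots> = expectation (\<lambda>\<omega>. indicator A \<omega> * (?X (Suc (Suc n)) \<omega>)\<^sup>2)"
          using second_moment[OF u bA] by (simp only: x_def m_def)
        also have "\<dots> = expectation (\<lambda>\<omega>. indicator A \<omega> * (?Y (Suc n) \<omega>)\<^sup>2) * g'\<^sup>2"
          using g(3) by (simp add: g'_def power_divide)
        finally show "expectation (\<lambda>\<omega>. indicator A \<omega> * (?Y n \<omega>)\<^sup>2) + w n * prob A
          \<le> expectation (\<lambda>\<omega>. indicator A \<omega> * (?Y (Suc n) \<omega>)\<^sup>2)"
          using g(3) by simp
      qed
    qed
  qed
  then show ?thesis
  proof eventually_elim
    case (elim \<omega>)
    show ?case
    proof
      assume "\<forall>\<^sub>F n in sequentially. 0 < S n \<omega> \<bullet> u"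
      then have "\<forall>\<^sub>F n in sequentially. 0 < S (Suc n) \<omega> \<bullet> u"
        by (subst eventually_sequentially_Suc)
      then have "\<forall>\<^sub>F n in sequentially. 0 < ?Y n \<omega>"
        by eventually_elim (simp add: gp)
      with elim show False by contradiction
    qed
  qed
qed

theorem diffusive_direction_diverges:
  assumes a: "a \<le> 1 / 2" and pq: "0 < q" "0 < p + q"
  shows "AE \<omega> in M. \<not> direction_converges (\<lambda>n. S n \<omega>)"
proof -
  have "AE \<omega> in M. \<forall>u\<in>unit_steps. \<not> (\<forall>\<^sub>F n in sequentially. 0 < S n \<omega> \<bullet> u)"
    using not_eventually_positive[OF a pq] by (intro AE_finite_allI) auto
  then show ?thesis by eventually_elim (blast dest: direction_converges_imp_positive)
qed

end

section \<open>Convergence of the direction\<close>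

theorem corollary1p7:
  fixes M :: "'w measure"
    and p :: real
    and i1 :: "'d :: finite"
    and N :: "nat \<Rightarrow> 'w \<Rightarrow> nat"
    and \<sigma> S :: "nat \<Rightarrow> 'w \<Rightarrow> real ^ 'd"
  assumes "elephant_random_walk M p i1 N \<sigma> S"
  shows "(p > p_crit CARD('d) \<longrightarrow>
            (AE \<omega> in M. direction_converges (\<lambda>n. S n \<omega>)))
       \<and> (CARD('d) \<ge> 3 \<and> p \<le> p_crit CARD('d) \<or> CARD('d) = 2 \<and> p = p_crit CARD('d) \<longrightarrow>
            {\<omega> \<in> space M. direction_converges (\<lambda>n. S n \<omega>)} \<in> sets M
            \<and> measure M {\<omega> \<in> space M. direction_converges (\<lambda>n. S n \<omega>)} = 0)"
proof -
  interpret elephant_random_walk M p i1 N \<sigma> S by (rule assms)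
  show ?thesis
  proof (intro conjI[of "_ \<longrightarrow> _"] impI)
    assume "p_crit CARD('d) < p"
    then show "AE \<omega> in M. direction_converges (\<lambda>n. S n \<omega>)"
      by (intro superdiffusive_direction_converges) (simp add: p_crit_iff)
  next
    assume "CARD('d) \<ge> 3 \<and> p \<le> p_crit CARD('d) \<or> CARD('d) = 2 \<and> p = p_crit CARD('d)"
    then have d: "2 \<le> real CARD('d)" and le: "p \<le> p_crit CARD('d)" by auto
    have "a \<le> 1 / 2" using le p_crit_iff by linarith
    moreover have "p_crit CARD('d) < 1" unfolding p_crit_def using d by (simp add: divide_less_eq)
    then have "0 < q" unfolding q_def using le denominator_pos by (intro divide_pos_pos) auto
    moreover have "0 \<le> p" using p_range by simp
    ultimately have "AE \<omega> in M. \<not> direction_converges (\<lambda>n. S n \<omega>)"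
      by (intro diffusive_direction_diverges) auto
    then show "{\<omega> \<in> space M. direction_converges (\<lambda>n. S n \<omega>)} \<in> sets M
        \<and> measure M {\<omega> \<in> space M. direction_converges (\<lambda>n. S n \<omega>)} = 0"
      using direction_converges_measurable by (simp add: prob_Collect_eq_0)
  qed
qed

end
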